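(* Let $F(x,y)=u\,\psi(r,s)$ be a spherically symmetric Finsler metric on an open subset $\mathcal{U}$ of $\mathbb{R}^n$, where $r=|x|$, $u=|y|$, $v=\langle x,y\rangle$, $s=v/u$, and let $P=P(r,s)$, $Q=Q(r,s)$ be the functions in its geodesic spray coefficients $G^i=uPy^i+u^2Qx^i$. Then the $E$-curvature of $F$ is given by $$\begin{aligned} E_{ij}=\frac12\Big[&\frac1u\Big\{(n+1)P_{ss}+2Q_s+(r^2-s^2)Q_{sss}-2sQ_{ss}\Big\}x^ix^j\\ &+\frac1{u^2}\Big\{-(n+1)sP_{ss}-2sQ_s-s(r^2-s^2)Q_{sss}+2s^2Q_{ss}\Big\}(x^iy^j+y^ix^j)\\ &+\frac1{u^3}\Big\{(n+1)s^2P_{ss}+2s^2Q_s+s^2(r^2-s^2)Q_{sss}-2s^3Q_{ss}+(n+1)sP_s-(n+1)P\\ &\qquad\quad+s(r^2-s^2)Q_{ss}-(r^2-s^2)Q_s\Big\}y^iy^j\\ &+\frac1u\Big\{-(n+1)sP_s+(n+1)P-s(r^2-s^2)Q_{ss}+(r^2-s^2)Q_s\Big\}\delta_{ij}\Big]. \end{aligned}$$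
   Context: A Finsler metric on an open set $\mathcal{U}\subseteq\mathbb{R}^n$ is a function $F:\mathcal{U}\times\mathbb{R}^n\to[0,\infty)$, $(x,y)\mapsto F(x,y)$, smooth where $y\neq 0$, with $F(x,\lambda y)=\lambda F(x,y)$ for all $\lambda>0$, and such that $g_{ij}=\frac12\frac{\partial^2 F^2}{\partial y^i\partial y^j}$ is positive definite for all $y\neq0$. $F$ is spherically symmetric if it is invariant under all rotations of $\mathbb{R}^n$; such a metric has the form $F=|y|\,\psi\left(|x|,\frac{\langle x,y\rangle}{|y|}\right)$ with $\psi$ a positive smooth function ($|\cdot|$, $\langle\cdot,\cdot\rangle$ the standard Euclidean norm and inner product). Repeated indices are summed; subscripts $x^k,y^l,r,s$ denote partial derivatives. The geodesic spray coefficients of $F$ are $G^i=\frac14 g^{il}\{(F^2)_{x^ky^l}y^k-(F^2)_{x^l}\}$, with $(g^{ij})=(g_{ij})^{-1}$. It is known that for a spherically symmetric $F=u\psi(r,s)$ one has $G^i=uPy^i+u^2Qx^i$ with $$Q=\frac{r\psi_{ss}+s\psi_{rs}-\psi_r}{2r(\psi-s\psi_s+(r^2-s^2)\psi_{ss})},\qquad P=\frac{s\psi_r+r\psi_s}{2r\psi}-\frac{s\psi+(r^2-s^2)\psi_s}{\psi}\,Q.$$ The $E$-curvature (mean Berwald curvature) of $F$ is $E_{ij}=\frac12\frac{\partial^2}{\partial y^i\partial y^j}\left(\frac{\partial G^k}{\partial y^k}\right)$. *)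

theory Defs
  imports "HOL-Analysis.Analysis"
begin

text \<open>\<open>k\<close>-fold continuous differentiability and smoothness on an open set.\<close>

fun Ck_on :: "nat \<Rightarrow> 'a::real_normed_vector set \<Rightarrow> ('a \<Rightarrow> real) \<Rightarrow> bool" where
  "Ck_on 0 S f \<longleftrightarrow> continuous_on S f"
| "Ck_on (Suc k) S f \<longleftrightarrow>
     (\<forall>x\<in>S. f differentiable (at x)) \<and> (\<forall>v. Ck_on k S (\<lambda>x. frechet_derivative f (at x) v))"

definition smooth_on :: "'a::real_normed_vector set \<Rightarrow> ('a \<Rightarrow> real) \<Rightarrow> bool" where
  "smooth_on S f \<longleftrightarrow> (\<forall>k. Ck_on k S f)"

text \<open>Partial derivative in the \<open>i\<close>-th coordinate direction.\<close>

definition pd :: "'n::finite \<Rightarrow> (real^'n \<Rightarrow> real) \<Rightarrow> real^'n \<Rightarrow> real" where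
  "pd i f y = deriv (\<lambda>t::real. f (y + t *\<^sub>R axis i 1)) 0"

text \<open>Fundamental tensor \<open>g\<^sub>i\<^sub>j\<close> of \<open>F\<close>.\<close>

definition fund_tensor :: "(real^'n \<Rightarrow> real^'n \<Rightarrow> real) \<Rightarrow> real^'n \<Rightarrow> real^'n \<Rightarrow> real^'n^'n" where
  "fund_tensor F x y = (\<chi> i j. 1/2 * pd i (pd j (\<lambda>y. (F x y)\<^sup>2)) y)"

definition finsler_metric_on :: "(real^'n) set \<Rightarrow> (real^'n \<Rightarrow> real^'n \<Rightarrow> real) \<Rightarrow> bool" where
  "finsler_metric_on U F \<longleftrightarrow>
     (\<forall>x\<in>U. \<forall>y. F x y \<ge> 0) \<and>
     smooth_on (U \<times> (- {0})) (\<lambda>(x, y). F x y) \<and>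
     (\<forall>x\<in>U. \<forall>y. \<forall>c>0. F x (c *\<^sub>R y) = c * F x y) \<and>
     (\<forall>x\<in>U. \<forall>y. y \<noteq> 0 \<longrightarrow> (\<forall>w. w \<noteq> 0 \<longrightarrow> w \<bullet> (fund_tensor F x y *v w) > 0))"

text \<open>Invariance under rotations. \<open>U\<close> itself need not be rotation invariant: the condition is
  imposed whenever both sides are defined.\<close>

definition spherically_symmetric_on :: "(real^'n) set \<Rightarrow> (real^'n \<Rightarrow> real^'n \<Rightarrow> real) \<Rightarrow> bool" where
  "spherically_symmetric_on U F \<longleftrightarrow>
     (\<forall>R. rotation_matrix R \<longrightarrow>
        (\<forall>x\<in>U. R *v x \<in> U \<longrightarrow> (\<forall>y. F (R *v x) (R *v y) = F x y)))"

text \<open>Geodesic spray coefficient \<open>G\<^sup>i\<close> of \<open>F\<close>.\<close>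

definition spray :: "(real^'n \<Rightarrow> real^'n \<Rightarrow> real) \<Rightarrow> 'n \<Rightarrow> real^'n \<Rightarrow> real^'n \<Rightarrow> real" where
  "spray F i x y =
     1/4 * (\<Sum>l\<in>UNIV. matrix_inv (fund_tensor F x y) $ i $ l *
       ((\<Sum>k\<in>UNIV. pd l (\<lambda>y'. pd k (\<lambda>x'. (F x' y')\<^sup>2) x) y * y $ k)
        - pd l (\<lambda>x'. (F x' y)\<^sup>2) x))"

definition E_curvature ::
  "(real^'n \<Rightarrow> real^'n \<Rightarrow> real) \<Rightarrow> 'n \<Rightarrow> 'n \<Rightarrow> real^'n \<Rightarrow> real^'n \<Rightarrow> real" where
  "E_curvature F i j x y =
     1/2 * pd i (pd j (\<lambda>y. \<Sum>k\<in>UNIV. pd k (\<lambda>y. spray F k x y) y)) y"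

text \<open>Partial derivatives of functions of \<open>(r, s)\<close>.\<close>

definition Dr :: "(real \<Rightarrow> real \<Rightarrow> real) \<Rightarrow> real \<Rightarrow> real \<Rightarrow> real" where
  "Dr f r s = deriv (\<lambda>r. f r s) r"

definition Ds :: "(real \<Rightarrow> real \<Rightarrow> real) \<Rightarrow> real \<Rightarrow> real \<Rightarrow> real" where
  "Ds f r s = deriv (\<lambda>s. f r s) s"

text \<open>The functions \<open>P\<close> and \<open>Q\<close> in the spray coefficients \<open>G\<^sup>i = u P y\<^sup>i + u\<^sup>2 Q x\<^sup>i\<close> of
  \<open>F = u \<psi>(r, s)\<close>. The closed formulas have \<open>r\<close> in the denominator; where \<open>r = 0\<close> the functions
  are taken to be the limits of these formulas as \<open>r\<close> tends to \<open>0\<close> from the right. (This matters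
  only at \<open>x = 0\<close>, where also \<open>s = 0\<close>.)\<close>

definition Q_formula :: "(real \<Rightarrow> real \<Rightarrow> real) \<Rightarrow> real \<Rightarrow> real \<Rightarrow> real" where
  "Q_formula \<psi> r s =
     (r * Ds (Ds \<psi>) r s + s * Ds (Dr \<psi>) r s - Dr \<psi> r s) /
     (2 * r * (\<psi> r s - s * Ds \<psi> r s + (r\<^sup>2 - s\<^sup>2) * Ds (Ds \<psi>) r s))"

definition P_formula :: "(real \<Rightarrow> real \<Rightarrow> real) \<Rightarrow> real \<Rightarrow> real \<Rightarrow> real" where
  "P_formula \<psi> r s =
     (s * Dr \<psi> r s + r * Ds \<psi> r s) / (2 * r * \<psi> r s)
     - (s * \<psi> r s + (r\<^sup>2 - s\<^sup>2) * Ds \<psi> r s) / \<psi> r s * Q_formula \<psi> r s"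

definition spray_Q :: "(real \<Rightarrow> real \<Rightarrow> real) \<Rightarrow> real \<Rightarrow> real \<Rightarrow> real" where
  "spray_Q \<psi> r s = (if r = 0 then Lim (at_right 0) (\<lambda>r. Q_formula \<psi> r s) else Q_formula \<psi> r s)"

definition spray_P :: "(real \<Rightarrow> real \<Rightarrow> real) \<Rightarrow> real \<Rightarrow> real \<Rightarrow> real" where
  "spray_P \<psi> r s = (if r = 0 then Lim (at_right 0) (\<lambda>r. P_formula \<psi> r s) else P_formula \<psi> r s)"

end

theory Submission
  imports Defs
begin

text \<open>
  Fix the point \<open>x\<close> and write \<open>r = |x|\<close>, \<open>u = |y|\<close>, \<open>s = \<langle>x, y\<rangle> / u\<close>. For fixed \<open>x\<close> every
  function of \<open>y\<close> in the problem is a power of \<open>u\<close> times a function of the single variable \<open>s\<close>,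
  and \<open>\<partial>u/\<partial>y\<^sup>i = y\<^sup>i/u\<close>, \<open>\<partial>s/\<partial>y\<^sup>i = (x\<^sup>i - s y\<^sup>i/u)/u\<close>. Once \<open>G\<^sup>i = u P y\<^sup>i + u\<^sup>2 Q x\<^sup>i\<close> is known,
  the divergence of \<open>G\<close> in \<open>y\<close> is \<open>u \<Phi>(s)\<close> with
  \<open>\<Phi> = (n+1) P + 2 s Q + (r\<^sup>2 - s\<^sup>2) Q\<^sub>s\<close> (lemma \<open>divergence_deg2\<close>), and the Hessian of \<open>u \<Phi>(s)\<close> is
  \<open>(1/u) {(\<Phi> - s \<Phi>\<^sub>s) (\<delta>\<^sub>i\<^sub>j - y\<^sup>i y\<^sup>j/u\<^sup>2) + \<Phi>\<^sub>s\<^sub>s (x\<^sup>i - s y\<^sup>i/u) (x\<^sup>j - s y\<^sup>j/u)}\<close>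
  (lemma \<open>hessian_deg1\<close>). The terms \<open>\<plusminus> 2 s Q\<^sub>s\<close> in \<open>\<Phi>\<^sub>s\<close> cancel,
  leaving \<open>\<Phi>\<^sub>s = (n+1) P\<^sub>s + 2 Q + (r\<^sup>2 - s\<^sup>2) Q\<^sub>s\<^sub>s\<close>, so \<open>Q\<close> itself drops out of both coefficients of the
  Hessian. Expanding gives the formula.

  The rest of the work is to establish the form of \<open>G\<close>, including the smoothness in \<open>s\<close> of \<open>P\<close> and
  \<open>Q\<close>. The inverse of \<open>g\<close> is never computed: \<open>g\<close> is a rank two perturbation of a multiple of the
  identity, so \<open>g\<close> applied to \<open>u P y + u\<^sup>2 Q x\<close> is an explicit combination of \<open>x\<close> and \<open>y\<close>, and it is
  compared with the bracket that defines the spray (lemma \<open>spray_eqI\<close>). The comparison reduces to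
  two linear equations for \<open>P\<close> and \<open>Q\<close> (lemma \<open>PQ_equations\<close>). Their solvability, and the smoothness
  of \<open>P\<close> and \<open>Q\<close> in \<open>s\<close>, rest on \<open>\<Delta> = \<psi> - s \<psi>\<^sub>s + (r\<^sup>2 - s\<^sup>2) \<psi>\<^sub>s\<^sub>s > 0\<close>, which follows from the
  positivity of \<open>g\<close> on the right test vector if \<open>n \<ge> 2\<close> (lemma \<open>\<Delta>_pos\<close>).

  Two cases lie outside this argument. In dimension one \<open>\<Delta>\<close> may vanish, so \<open>P\<close> and \<open>Q\<close> may be
  arbitrary; but there the spray is a constant multiple of \<open>y\<^sup>2\<close> on each half line, so its third
  derivative is zero, and the right-hand side is zero because \<open>x = (s/u) y\<close>. At \<open>x = 0\<close> the formulas for \<open>P\<close> and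
  \<open>Q\<close> divide by \<open>r = 0\<close>. Differentiability of \<open>F\<close> at \<open>(0, y)\<close> along both directions of a line through
  the origin forces \<open>\<psi>\<^sub>r(0, 0) = 0\<close>, the spray is \<open>u y\<^sup>i \<psi>\<^sub>s/(2 \<psi>)\<close>, and this coefficient is the limit
  of \<open>P(r, 0)\<close>.
\<close>

section \<open>Repeatedly differentiable functions of one real variable\<close>

text \<open>The coefficients \<open>P\<close> and \<open>Q\<close> have to be differentiated only in \<open>s\<close>, two and three times. Asking
  just for the existence of a derivative function at each stage makes the closure rules below
  short inductions.\<close>

fun diff_times :: "nat \<Rightarrow> real set \<Rightarrow> (real \<Rightarrow> real) \<Rightarrow> bool" where
  "diff_times 0 S f \<longleftrightarrow> True"
| "diff_times (Suc k) S f \<longleftrightarrow>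
     (\<exists>f'. (\<forall>s\<in>S. (f has_real_derivative f' s) (at s)) \<and> diff_times k S f')"

lemma diff_times_Suc_imp: "diff_times (Suc k) S f \<Longrightarrow> diff_times k S f"
  by (induction k arbitrary: f) auto

lemma diff_times_cong:
  assumes "open S" and "\<And>s. s \<in> S \<Longrightarrow> f s = g s" and "diff_times k S g"
  shows "diff_times k S f"
proof (cases k)
  case (Suc m)
  then obtain g' where g': "\<And>s. s \<in> S \<Longrightarrow> (g has_real_derivative g' s) (at s)" "diff_times m S g'"
    using assms(3) by auto
  have "(f has_real_derivative g' s) (at s)" if "s \<in> S" for s
    using has_field_derivative_transform_within_open[OF g'(1)[OF that] assms(1) that] assms(2)
    by metis
  then show ?thesis using g'(2) Suc by auto
qed simp

lemma diff_times_subset: "T \<subseteq> S \<Longrightarrow> diff_times k S f \<Longrightarrow> diff_times k T f"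
proof (induction k arbitrary: f)
  case (Suc k)
  then obtain f' where "\<forall>s\<in>S. (f has_real_derivative f' s) (at s)" "diff_times k S f'" by auto
  then show ?case using Suc.IH Suc.prems(1) by auto
qed simp

lemma diff_times_const: "diff_times k S (\<lambda>_. c)"
  by (induction k arbitrary: c) (auto intro!: exI[of _ "\<lambda>_. 0"])

lemma diff_times_ident: "diff_times k S (\<lambda>s. s)"
  by (cases k) (auto intro!: exI[of _ "\<lambda>_. 1"] diff_times_const)

lemma diff_times_add:
  "diff_times k S f \<Longrightarrow> diff_times k S g \<Longrightarrow> diff_times k S (\<lambda>s. f s + g s)"
proof (induction k arbitrary: f g)
  case (Suc k)
  then obtain f' g' where "\<forall>s\<in>S. (f has_real_derivative f' s) (at s)" "diff_times k S f'"
     "\<forall>s\<in>S. (g has_real_derivative g' s) (at s)" "diff_times k S g'" by auto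
  with Suc.IH show ?case
    by (auto intro!: exI[of _ "\<lambda>s. f' s + g' s"] derivative_intros)
qed simp

lemma diff_times_mult:
  "diff_times k S f \<Longrightarrow> diff_times k S g \<Longrightarrow> diff_times k S (\<lambda>s. f s * g s)"
proof (induction k arbitrary: f g)
  case (Suc k)
  then obtain f' g' where "\<forall>s\<in>S. (f has_real_derivative f' s) (at s)" "diff_times k S f'"
     "\<forall>s\<in>S. (g has_real_derivative g' s) (at s)" "diff_times k S g'" by auto
  with Suc.IH Suc.prems[THEN diff_times_Suc_imp] show ?case
    by (auto intro!: exI[of _ "\<lambda>s. f' s * g s + g' s * f s"] diff_times_add derivative_eq_intros)
qed simp

lemma diff_times_minus: "diff_times k S f \<Longrightarrow> diff_times k S (\<lambda>s. - f s)"
  using diff_times_mult[OF diff_times_const[of k S "-1"], of f] by simp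

lemma diff_times_diff:
  "diff_times k S f \<Longrightarrow> diff_times k S g \<Longrightarrow> diff_times k S (\<lambda>s. f s - g s)"
  using diff_times_add[OF _ diff_times_minus, of k S f g] by simp

lemma diff_times_inverse:
  assumes "\<And>s. s \<in> S \<Longrightarrow> f s \<noteq> 0"
  shows "diff_times k S f \<Longrightarrow> diff_times k S (\<lambda>s. inverse (f s))"
proof (induction k)
  case (Suc k)
  then obtain f' where f': "\<forall>s\<in>S. (f has_real_derivative f' s) (at s)" "diff_times k S f'"
    by auto
  have "diff_times k S (\<lambda>s. inverse (f s))"
    using Suc diff_times_Suc_imp by blast
  then have "diff_times k S (\<lambda>s. - (inverse (f s) * f' s * inverse (f s)))"
    using f'(2) by (intro diff_times_minus diff_times_mult)
  moreover have "\<forall>s\<in>S. ((\<lambda>s. inverse (f s)) has_real_derivative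
                     - (inverse (f s) * f' s * inverse (f s))) (at s)"
    using f'(1) assms by (auto intro!: DERIV_inverse')
  ultimately show ?case by (auto intro!: exI[of _ "\<lambda>s. - (inverse (f s) * f' s * inverse (f s))"])
qed simp

lemma diff_times_divide:
  "diff_times k S f \<Longrightarrow> diff_times k S g \<Longrightarrow> (\<And>s. s \<in> S \<Longrightarrow> g s \<noteq> 0)
    \<Longrightarrow> diff_times k S (\<lambda>s. f s / g s)"
  using diff_times_mult[OF _ diff_times_inverse, of k S f g] by (simp add: divide_inverse)

lemma diff_times_deriv:
  assumes "open S" "diff_times (Suc k) S f"
  shows "diff_times k S (deriv f)" "\<And>s. s \<in> S \<Longrightarrow> (f has_real_derivative deriv f s) (at s)"
proof -
  obtain f' where f': "\<And>s. s \<in> S \<Longrightarrow> (f has_real_derivative f' s) (at s)" "diff_times k S f'"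
    using assms(2) by auto
  then have d: "deriv f s = f' s" if "s \<in> S" for s using that DERIV_imp_deriv by blast
  then show "diff_times k S (deriv f)" using f'(2) assms(1) diff_times_cong by metis
  show "\<And>s. s \<in> S \<Longrightarrow> (f has_real_derivative deriv f s) (at s)" using d f'(1) by simp
qed

section \<open>Smooth functions on the plane\<close>

lemma frechet_derivative_cong_open:
  assumes "open S" "x \<in> S" "\<And>z. z \<in> S \<Longrightarrow> f z = g z"
  shows "frechet_derivative f (at x) = frechet_derivative g (at x)"
proof -
  have "(f has_derivative D) (at x) \<longleftrightarrow> (g has_derivative D) (at x)" for D
    using has_derivative_transform_within_open[OF _ assms(1,2)] assms(3) by metis
  then show ?thesis unfolding frechet_derivative_def by simp
qed

lemma Ck_on_cong:
  assumes "open S" "\<And>z. z \<in> S \<Longrightarrow> f z = g z"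
  shows "Ck_on k S f \<Longrightarrow> Ck_on k S g"
  using assms(2)
proof (induction k arbitrary: f g)
  case 0
  then show ?case using continuous_on_cong[OF refl, of S f g] by simp
next
  case (Suc k)
  have eq: "frechet_derivative f (at x) = frechet_derivative g (at x)" if "x \<in> S" for x
    using frechet_derivative_cong_open[OF assms(1) that] Suc.prems(2) by blast
  have "g differentiable at x" if "x \<in> S" for x
  proof -
    have "f differentiable at x" using Suc.prems that by auto
    then show ?thesis
      using has_derivative_transform_within_open[OF _ assms(1) that] Suc.prems(2)
      unfolding differentiable_def by metis
  qed
  moreover have "Ck_on k S (\<lambda>x. frechet_derivative g (at x) v)" for v
    by (rule Suc.IH[of "\<lambda>x. frechet_derivative f (at x) v"]) (use Suc.prems eq in auto)
  ultimately show ?case by simp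
qed

lemma linear_along:
  fixes f :: "'a::real_vector \<Rightarrow> real"
  assumes "linear f"
  shows "(\<lambda>h. f (h *\<^sub>R v)) = (*) (f v)"
  by (rule ext) (simp add: linear_cmul[OF assms] mult.commute)

text \<open>Partial derivatives of a smooth function are values of its Frechet derivative on basis vectors,
  hence smooth themselves; off \<open>W\<close> the two notions may disagree, so congruence on the open set
  \<open>W\<close> is what transfers smoothness.\<close>

lemma smooth_on_partials:
  assumes "open W" "smooth_on W (\<lambda>(r, s). f r s)"
  shows smooth_on_has_derivative: "\<And>r s. (r, s) \<in> W \<Longrightarrow>
           ((\<lambda>(r, s). f r s) has_derivative (\<lambda>(a, b). a * Dr f r s + b * Ds f r s)) (at (r, s))"
    and smooth_on_Dr: "smooth_on W (\<lambda>(r, s). Dr f r s)"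
    and smooth_on_Ds: "smooth_on W (\<lambda>(r, s). Ds f r s)"
proof -
  let ?D = "\<lambda>p. frechet_derivative (\<lambda>(r, s). f r s) (at p)"
  have Ck: "Ck_on k W (\<lambda>p. ?D p v)" for k v
    using assms(2) Ck_on.simps(2) unfolding smooth_on_def by blast
  have hd: "((\<lambda>(r, s). f r s) has_derivative ?D p) (at p)" if "p \<in> W" for p
  proof -
    have "Ck_on (Suc 0) W (\<lambda>(r, s). f r s)" using assms(2) unfolding smooth_on_def by blast
    then show ?thesis using that by (simp add: frechet_derivative_works)
  qed
  have r: "?D (r, s) (1, 0) = Dr f r s" and s: "?D (r, s) (0, 1) = Ds f r s"
    if W: "(r, s) \<in> W" for r s
  proof -
    interpret D: bounded_linear "?D (r, s)"
      using hd[OF W] by (rule has_derivative_bounded_linear)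
    have "((\<lambda>t. (\<lambda>(r, s). f r s) (t, s)) has_derivative (\<lambda>h. ?D (r, s) (h *\<^sub>R (1, 0)))) (at r)"
      by (rule has_derivative_compose[where f="\<lambda>t. (t, s)"])
        (auto intro!: derivative_eq_intros hd W)
    moreover have "(\<lambda>h. ?D (r, s) (h *\<^sub>R (1, 0))) = (*) (?D (r, s) (1, 0))"
      by (rule linear_along) (rule D.linear_axioms)
    ultimately have "((\<lambda>t. f t s) has_real_derivative ?D (r, s) (1, 0)) (at r)"
      unfolding has_field_derivative_def by simp
    then show "?D (r, s) (1, 0) = Dr f r s" unfolding Dr_def by (simp add: DERIV_imp_deriv)
    have "((\<lambda>t. (\<lambda>(r, s). f r s) (r, t)) has_derivative (\<lambda>h. ?D (r, s) (h *\<^sub>R (0, 1)))) (at s)"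
      by (rule has_derivative_compose[where f="\<lambda>t. (r, t)"])
        (auto intro!: derivative_eq_intros hd W)
    moreover have "(\<lambda>h. ?D (r, s) (h *\<^sub>R (0, 1))) = (*) (?D (r, s) (0, 1))"
      by (rule linear_along) (rule D.linear_axioms)
    ultimately have "((\<lambda>t. f r t) has_real_derivative ?D (r, s) (0, 1)) (at s)"
      unfolding has_field_derivative_def by simp
    then show "?D (r, s) (0, 1) = Ds f r s" unfolding Ds_def by (simp add: DERIV_imp_deriv)
  qed
  show "((\<lambda>(r, s). f r s) has_derivative (\<lambda>(a, b). a * Dr f r s + b * Ds f r s)) (at (r, s))"
    if W: "(r, s) \<in> W" for r s
  proof -
    interpret D: bounded_linear "?D (r, s)"
      using hd[OF W] by (rule has_derivative_bounded_linear)
    have "?D (r, s) (a, b) = a * Dr f r s + b * Ds f r s" for a b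
    proof -
      have "?D (r, s) (a *\<^sub>R (1, 0) + b *\<^sub>R (0, 1)) = a * Dr f r s + b * Ds f r s"
        by (simp only: D.add D.scaleR r[OF W] s[OF W] real_scaleR_def)
      then show ?thesis by simp
    qed
    then have "?D (r, s) = (\<lambda>(a, b). a * Dr f r s + b * Ds f r s)" by auto
    then show ?thesis using hd[OF W] by simp
  qed
  show "smooth_on W (\<lambda>(r, s). Dr f r s)"
    unfolding smooth_on_def
    by (intro allI Ck_on_cong[OF assms(1) _ Ck[of _ "(1, 0)"]]) (auto simp: r)
  show "smooth_on W (\<lambda>(r, s). Ds f r s)"
    unfolding smooth_on_def
    by (intro allI Ck_on_cong[OF assms(1) _ Ck[of _ "(0, 1)"]]) (auto simp: s)
qed

lemma smooth_on_DERIV_s: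
  assumes "open W" "smooth_on W (\<lambda>(r, s). f r s)" "(r, s) \<in> W"
  shows "(f r has_real_derivative Ds f r s) (at s)"
proof -
  have "((\<lambda>t. (\<lambda>(r, s). f r s) (r, t)) has_derivative
          (\<lambda>h. (\<lambda>(a, b). a * Dr f r s + b * Ds f r s) (0, h))) (at s)"
    by (rule has_derivative_compose[where f="\<lambda>t. (r, t)", OF _ smooth_on_has_derivative[OF assms]])
      (auto intro!: derivative_eq_intros)
  then show ?thesis by (simp add: has_field_derivative_def mult_commute_abs)
qed

lemma smooth_on_continuous:
  assumes "smooth_on W f" shows "continuous_on W f"
  using assms Ck_on.simps(1) unfolding smooth_on_def by blast

lemma open_slice: "open W \<Longrightarrow> open {s. (r, s) \<in> W}" for r :: "'a::topological_space" and W :: "('a \<times> 'b::topological_space) set"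
  using open_vimage[of W "Pair r"] by (simp add: vimage_def continuous_on_Pair)

text \<open>Derivatives in \<open>s\<close> for fixed \<open>r\<close> stay within the smooth functions of \<open>(r, s)\<close>, so slices can be
  differentiated any number of times.\<close>

lemma smooth_on_slice:
  fixes f :: "real \<Rightarrow> real \<Rightarrow> real"
  assumes "open W" "smooth_on W (\<lambda>(r, s). f r s)"
  shows "diff_times k {s. (r, s) \<in> W} (f r)"
  using assms(2)
proof (induction k arbitrary: f)
  case (Suc k)
  have "diff_times k {s. (r, s) \<in> W} (Ds f r)"
    by (rule Suc.IH[OF smooth_on_Ds[OF assms(1) Suc.prems]])
  moreover have "\<forall>s\<in>{s. (r, s) \<in> W}. (f r has_real_derivative Ds f r s) (at s)"
    using smooth_on_DERIV_s[OF assms(1) Suc.prems] by blast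
  ultimately show ?case by auto
qed simp

section \<open>Partial derivatives in vector space\<close>

text \<open>Unlike \<open>pd\<close>, this relation carries existence of the derivative, so it obeys the usual rules of
  differentiation without side conditions.\<close>

definition has_pd :: "'n::finite \<Rightarrow> (real^'n \<Rightarrow> real) \<Rightarrow> real \<Rightarrow> real^'n \<Rightarrow> bool" where
  "has_pd i f D y \<longleftrightarrow> ((\<lambda>t. f (y + t *\<^sub>R axis i 1)) has_real_derivative D) (at 0)"

lemma has_pd_imp_pd: "has_pd i f D y \<Longrightarrow> pd i f y = D"
  unfolding has_pd_def pd_def by (rule DERIV_imp_deriv)

lemma has_pd_cong:
  assumes "has_pd i g D y" "open S" "y \<in> S" "\<And>z. z \<in> S \<Longrightarrow> f z = g z"
  shows "has_pd i f D y"
proof -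
  let ?l = "\<lambda>t::real. y + t *\<^sub>R axis i 1"
  have "open (?l -` S)" by (rule open_vimage) (auto intro!: continuous_intros assms)
  then show ?thesis
    using assms unfolding has_pd_def
    by (elim has_field_derivative_transform_within_open) auto
qed

lemma pd_cong:
  assumes "open S" "y \<in> S" "\<And>z. z \<in> S \<Longrightarrow> f z = g z"
  shows "pd i f y = pd i g y"
proof -
  have "has_pd i f D y \<longleftrightarrow> has_pd i g D y" for D
    using has_pd_cong[OF _ assms(1,2)] assms(3) by metis
  then show ?thesis by (simp add: pd_def deriv_def has_pd_def)
qed

text \<open>Used to differentiate by composing rules first and comparing the resulting value afterwards.\<close>

lemma has_pd_eq: "has_pd i f D y \<Longrightarrow> D = E \<Longrightarrow> has_pd i f E y" by simp

lemma has_pd_const: "has_pd i (\<lambda>_. c) 0 y"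
  unfolding has_pd_def by simp

lemma has_pd_add: "has_pd i f D y \<Longrightarrow> has_pd i g E y \<Longrightarrow> has_pd i (\<lambda>y. f y + g y) (D + E) y"
  unfolding has_pd_def by (rule DERIV_add)

lemma has_pd_diff: "has_pd i f D y \<Longrightarrow> has_pd i g E y \<Longrightarrow> has_pd i (\<lambda>y. f y - g y) (D - E) y"
  unfolding has_pd_def by (rule DERIV_diff)

lemma has_pd_mult:
  "has_pd i f D y \<Longrightarrow> has_pd i g E y \<Longrightarrow> has_pd i (\<lambda>y. f y * g y) (D * g y + E * f y) y"
  unfolding has_pd_def using DERIV_mult by fastforce

lemma has_pd_chain:
  "(h has_real_derivative h') (at (f y)) \<Longrightarrow> has_pd i f D y \<Longrightarrow> has_pd i (\<lambda>y. h (f y)) (h' * D) y"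
  unfolding has_pd_def
  using DERIV_chain2[where f=h and g="\<lambda>t. f (y + t *\<^sub>R axis i 1)" and x=0] by simp

lemma has_pd_has_derivative:
  assumes "(f has_derivative f') (at y)" shows "has_pd i f (f' (axis i 1)) y"
proof -
  have "((\<lambda>t. f (y + t *\<^sub>R axis i 1)) has_derivative (\<lambda>t. f' (t *\<^sub>R axis i 1))) (at 0)"
    by (rule has_derivative_compose[where f="\<lambda>t. y + t *\<^sub>R axis i 1"])
      (auto intro!: derivative_eq_intros assms)
  moreover have "(\<lambda>t. f' (t *\<^sub>R axis i 1)) = (*) (f' (axis i 1))"
    by (rule linear_along[OF has_derivative_linear[OF assms]])
  ultimately show ?thesis unfolding has_pd_def has_field_derivative_def by simp
qed

lemma has_pd_component: "has_pd i (\<lambda>y. y $ k) (if i = k then 1 else 0) y"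
  by (rule has_pd_eq[OF has_pd_has_derivative[OF bounded_linear_imp_has_derivative]])
    (auto simp: axis_def bounded_linear_vec_nth)

lemma has_pd_inner: "has_pd i (\<lambda>y. x \<bullet> y) (x $ i) y"
  by (rule has_pd_eq[OF has_pd_has_derivative[OF bounded_linear_imp_has_derivative]])
    (auto simp: inner_axis bounded_linear_inner_right)

lemma has_pd_norm: "y \<noteq> 0 \<Longrightarrow> has_pd i norm (y $ i / norm y) y"
  by (rule has_pd_eq[OF has_pd_has_derivative[OF has_derivative_norm]])
    (auto simp: inner_axis' sgn_div_norm divide_inverse mult.commute)

text \<open>The variable \<open>s\<close> of the problem, as a function of the point and the direction.\<close>

definition dir_comp :: "real^'n \<Rightarrow> real^'n \<Rightarrow> real" where "dir_comp x y = (x \<bullet> y) / norm y"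

lemma has_pd_dir_comp:
  assumes "y \<noteq> 0"
  shows "has_pd i (dir_comp x) ((x $ i - dir_comp x y * y $ i / norm y) / norm y) y"
proof -
  have "((\<lambda>u::real. inverse u) has_real_derivative - (1 / (norm y)^2)) (at (norm y))"
    using assms by (auto intro!: derivative_eq_intros simp: field_simps power2_eq_square)
  from has_pd_mult[OF has_pd_inner has_pd_chain[OF this has_pd_norm[OF assms]]]
  have "has_pd i (\<lambda>y. (x \<bullet> y) * inverse (norm y))
     (x $ i * inverse (norm y) + - (1 / (norm y)\<^sup>2) * (y $ i / norm y) * (x \<bullet> y)) y" .
  then have "has_pd i (dir_comp x)
     (x $ i * inverse (norm y) + - (1 / (norm y)\<^sup>2) * (y $ i / norm y) * (x \<bullet> y)) y"
    unfolding dir_comp_def[abs_def] by (simp add: divide_inverse)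
  then show ?thesis
    by (rule has_pd_eq) (use assms in \<open>simp add: dir_comp_def field_simps power2_eq_square\<close>)
qed

lemma inner_eq_norm_dir_comp: "y \<noteq> 0 \<Longrightarrow> x \<bullet> y = norm y * dir_comp x y"
  by (simp add: dir_comp_def)

lemma sum_sqr_norm: "(\<Sum>k\<in>UNIV. (y::real^'n) $ k * y $ k) = (norm y)\<^sup>2"
  by (simp add: power2_norm_eq_inner inner_vec_def)

lemma sum_inner: "(\<Sum>k\<in>UNIV. (x::real^'n) $ k * y $ k) = x \<bullet> y"
  by (simp add: inner_vec_def)

text \<open>The functions \<open>u f(s)\<close> are positively homogeneous of degree one in \<open>y\<close>; the functions \<open>u\<^sup>2 f(s)\<close>
  below are of degree two.\<close>

lemma has_pd_deg1:
  assumes "y \<noteq> 0" "(f has_real_derivative f') (at (dir_comp x y))"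
  shows "has_pd j (\<lambda>y. norm y * f (dir_comp x y))
     (y $ j / norm y * f (dir_comp x y) + f' * (x $ j - dir_comp x y * y $ j / norm y)) y"
  by (rule has_pd_eq[OF has_pd_mult[OF has_pd_norm has_pd_chain[OF assms(2) has_pd_dir_comp]]])
    (use assms(1) in \<open>auto simp: field_simps\<close>)

text \<open>Differentiating \<open>(y\<^sup>j/u) f + f' (x\<^sup>j - s y\<^sup>j/u)\<close> once more: the mixed terms in \<open>f'\<close> combine to
  \<open>- s f'/u\<close> times the projection orthogonal to \<open>y\<close>.\<close>

lemma hessian_deg1:
  fixes x y :: "real^'n"
  assumes "y \<noteq> 0"
    and 1: "\<And>z. z \<noteq> 0 \<Longrightarrow> (f has_real_derivative f' (dir_comp x z)) (at (dir_comp x z))"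
    and 2: "(f' has_real_derivative f'') (at (dir_comp x y))"
  shows "pd i (pd j (\<lambda>y. norm y * f (dir_comp x y))) y =
    1 / norm y * ((f (dir_comp x y) - dir_comp x y * f' (dir_comp x y)) * ((if i = j then 1 else 0) - y $ i * y $ j / (norm y)\<^sup>2)
      + f'' * (x $ i - dir_comp x y * y $ i / norm y) * (x $ j - dir_comp x y * y $ j / norm y))"
proof -
  define S where "S = - {0 :: real^'n}"
  have S: "open S" "y \<in> S" using assms(1) by (auto simp: S_def)
  have n: "norm y > 0" using assms(1) by simp
  let ?e = "\<lambda>y. y $ j * (f (dir_comp x y) * inverse (norm y)) + f' (dir_comp x y) * (x $ j - dir_comp x y * (y $ j * inverse (norm y)))"
  have *: "pd j (\<lambda>y. norm y * f (dir_comp x y)) z = ?e z" if "z \<in> S" for z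
    by (subst has_pd_imp_pd[OF has_pd_deg1[OF _ 1]]) (use that in \<open>auto simp: S_def divide_inverse mult_ac\<close>)
  have i: "has_pd i (\<lambda>y. inverse (norm y)) (- (1 / (norm y)^2) * (y $ i / norm y)) y"
    by (rule has_pd_chain[OF _ has_pd_norm[OF assms(1)]])
      (use n in \<open>auto intro!: derivative_eq_intros simp: field_simps power2_eq_square\<close>)
  note s = has_pd_dir_comp[OF assms(1), of i x]
  note k = has_pd_component[of i j y]
  have "has_pd i ?e (1 / norm y * ((f (dir_comp x y) - dir_comp x y * f' (dir_comp x y)) * ((if i = j then 1 else 0) - y $ i * y $ j / (norm y)\<^sup>2)
      + f'' * (x $ i - dir_comp x y * y $ i / norm y) * (x $ j - dir_comp x y * y $ j / norm y))) y"
    by (rule has_pd_eq[OF has_pd_add[OF has_pd_mult[OF k has_pd_mult[OF has_pd_chain[OF 1[OF assms(1)] s] i]]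
       has_pd_mult[OF has_pd_chain[OF 2 s] has_pd_diff[OF has_pd_const has_pd_mult[OF s has_pd_mult[OF k i]]]]]])
     (use n in \<open>simp add: field_simps power2_eq_square power3_eq_cube\<close>)
  then show ?thesis
    by (rule has_pd_imp_pd[OF has_pd_cong[OF _ S]]) (use * in auto)
qed

text \<open>Since \<open>s\<close> is constant along rays, \<open>y\<^sup>k \<partial>s/\<partial>y\<^sup>k = 0\<close>, so \<open>p\<close> enters without its derivative, with
  \<open>n\<close> from \<open>\<partial>y\<^sup>k/\<partial>y\<^sup>k\<close> and \<open>1\<close> from the homogeneity of \<open>u\<close>; and \<open>x\<^sup>k \<partial>s/\<partial>y\<^sup>k = (r\<^sup>2 - s\<^sup>2)/u\<close> gives
  the term with \<open>q'\<close>.\<close>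

lemma divergence_deg2:
  fixes x y :: "real^'n"
  assumes "y \<noteq> 0"
    and p: "(p has_real_derivative p') (at (dir_comp x y))" and q: "(q has_real_derivative q') (at (dir_comp x y))"
    and G: "\<And>k z. z \<noteq> 0 \<Longrightarrow> G k z = norm z * p (dir_comp x z) * z $ k + (norm z)\<^sup>2 * q (dir_comp x z) * x $ k"
  shows "(\<Sum>k\<in>UNIV. pd k (G k) y) = norm y * ((real CARD('n) + 1) * p (dir_comp x y) +
     2 * dir_comp x y * q (dir_comp x y) + ((norm x)\<^sup>2 - (dir_comp x y)\<^sup>2) * q')"
proof -
  define S where "S = - {0 :: real^'n}"
  have S: "open S" "y \<in> S" using assms(1) by (auto simp: S_def)
  have n: "norm y > 0" using assms(1) by simp
  let ?s = "dir_comp x y" let ?u = "norm y"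
  have "pd k (G k) y = p ?s / ?u * (y $ k * y $ k) + p' * (x $ k * y $ k - ?s / ?u * (y $ k * y $ k))
      + ?u * p ?s + 2 * q ?s * (x $ k * y $ k) + ?u * q' * (x $ k * x $ k - ?s / ?u * (x $ k * y $ k))" for k
  proof -
    note s = has_pd_dir_comp[OF assms(1), of k x]
    note u = has_pd_norm[OF assms(1), of k]
    have "has_pd k (\<lambda>y. norm y * p (dir_comp x y) * y $ k + norm y * norm y * q (dir_comp x y) * x $ k)
      (p ?s / ?u * (y $ k * y $ k) + p' * (x $ k * y $ k - ?s / ?u * (y $ k * y $ k))
      + ?u * p ?s + 2 * q ?s * (x $ k * y $ k) + ?u * q' * (x $ k * x $ k - ?s / ?u * (x $ k * y $ k))) y"
      by (rule has_pd_eq[OF has_pd_add[OF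
          has_pd_mult[OF has_pd_mult[OF u has_pd_chain[OF p s]] has_pd_component]
          has_pd_mult[OF has_pd_mult[OF has_pd_mult[OF u u] has_pd_chain[OF q s]] has_pd_const]]])
        (use n in \<open>simp add: field_simps power2_eq_square power3_eq_cube\<close>)
    then show ?thesis
      by (rule has_pd_imp_pd[OF has_pd_cong[OF _ S]]) (auto simp: G S_def power2_eq_square)
  qed
  then have "(\<Sum>k\<in>UNIV. pd k (G k) y) = p ?s / ?u * ?u\<^sup>2 + p' * (x \<bullet> y - ?s / ?u * ?u\<^sup>2)
      + real CARD('n) * (?u * p ?s) + 2 * q ?s * (x \<bullet> y) + ?u * q' * ((norm x)\<^sup>2 - ?s / ?u * (x \<bullet> y))"
    by (simp add: sum.distrib sum_subtractf sum_sqr_norm sum_inner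
          del: times_divide_eq_left times_divide_eq_right flip: sum_distrib_left)
  also have "\<dots> = ?u * ((real CARD('n) + 1) * p ?s + 2 * ?s * q ?s + ((norm x)\<^sup>2 - ?s\<^sup>2) * q')"
    using n by (simp add: inner_eq_norm_dir_comp[OF assms(1)] field_simps power2_eq_square)
  finally show ?thesis .
qed

text \<open>With \<open>f = \<psi>\<^sup>2\<close> this is twice the fundamental tensor.\<close>

lemma hessian_deg2:
  fixes x y :: "real^'n"
  assumes "y \<noteq> 0"
    and 1: "\<And>z. z \<noteq> 0 \<Longrightarrow> (f has_real_derivative f' (dir_comp x z)) (at (dir_comp x z))"
    and 2: "(f' has_real_derivative f'') (at (dir_comp x y))"
  shows "pd i (pd j (\<lambda>y. (norm y)\<^sup>2 * f (dir_comp x y))) y =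
    (2 * f (dir_comp x y) - dir_comp x y * f' (dir_comp x y)) * (if i = j then 1 else 0)
     + (f' (dir_comp x y) - dir_comp x y * f'') / norm y * (x $ i * y $ j + y $ i * x $ j)
     - dir_comp x y * (f' (dir_comp x y) - dir_comp x y * f'') / (norm y)\<^sup>2 * (y $ i * y $ j)
     + f'' * (x $ i * x $ j)"
proof -
  define S where "S = - {0 :: real^'n}"
  have S: "open S" "y \<in> S" using assms(1) by (auto simp: S_def)
  have n: "norm y > 0" using assms(1) by simp
  let ?e = "\<lambda>y. (2 * f (dir_comp x y) - dir_comp x y * f' (dir_comp x y)) * y $ j + norm y * f' (dir_comp x y) * x $ j"
  have *: "pd j (\<lambda>y. (norm y)\<^sup>2 * f (dir_comp x y)) z = ?e z" if "z \<in> S" for z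
  proof -
    have z: "z \<noteq> 0" using that by (simp add: S_def)
    have "has_pd j (\<lambda>y. norm y * (norm y * f (dir_comp x y))) (?e z) z"
      by (rule has_pd_eq[OF has_pd_mult[OF has_pd_norm[OF z] has_pd_deg1[OF z 1[OF z]]]])
        (use z in \<open>simp add: field_simps\<close>)
    then show ?thesis by (simp add: has_pd_imp_pd power2_eq_square mult.assoc)
  qed
  note s = has_pd_dir_comp[OF assms(1), of i x]
  note k = has_pd_component[of i j y]
  note c = has_pd_const
  have "has_pd i ?e ((2 * f (dir_comp x y) - dir_comp x y * f' (dir_comp x y)) * (if i = j then 1 else 0)
     + (f' (dir_comp x y) - dir_comp x y * f'') / norm y * (x $ i * y $ j + y $ i * x $ j)
     - dir_comp x y * (f' (dir_comp x y) - dir_comp x y * f'') / (norm y)\<^sup>2 * (y $ i * y $ j)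
     + f'' * (x $ i * x $ j)) y"
    by (rule has_pd_eq[OF has_pd_add[OF
       has_pd_mult[OF has_pd_diff[OF has_pd_mult[OF c has_pd_chain[OF 1[OF assms(1)] s]]
          has_pd_mult[OF s has_pd_chain[OF 2 s]]] k]
       has_pd_mult[OF has_pd_mult[OF has_pd_norm[OF assms(1)] has_pd_chain[OF 2 s]] c]]])
     (use n in \<open>simp add: field_simps power2_eq_square power3_eq_cube\<close>)
  then show ?thesis
    by (rule has_pd_imp_pd[OF has_pd_cong[OF _ S]]) (use * in auto)
qed

text \<open>For differentiation in the base point, where both arguments of \<open>\<psi>\<close> vary.\<close>

lemma has_pd_chain2:
  assumes "((\<lambda>(a, b). h a b) has_derivative (\<lambda>(a, b). a * ha + b * hb)) (at (f y, g y))"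
    and "has_pd i f D y" "has_pd i g E y"
  shows "has_pd i (\<lambda>y. h (f y) (g y)) (D * ha + E * hb) y"
proof -
  let ?l = "\<lambda>t::real. y + t *\<^sub>R axis i 1"
  have "((\<lambda>t. (f (?l t), g (?l t))) has_derivative (\<lambda>t. (D * t, E * t))) (at 0)"
    using assms(2,3) unfolding has_pd_def has_field_derivative_def by (rule has_derivative_Pair)
  from has_derivative_compose[OF this, of "\<lambda>(a, b). h a b" "\<lambda>(a, b). a * ha + b * hb"] assms(1)
  have "((\<lambda>t. h (f (?l t)) (g (?l t))) has_derivative (\<lambda>t. D * t * ha + E * t * hb)) (at 0)"
    by simp
  then show ?thesis unfolding has_pd_def has_field_derivative_def
    by (rule has_derivative_eq_rhs) (auto simp: algebra_simps)
qed

lemma Ds_eq_deriv: "Ds f r = deriv (f r)"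
  by (rule ext) (simp add: Ds_def)

section \<open>From spray coefficients to the curvature\<close>

text \<open>The statement is about arbitrary functions \<open>p\<close> and \<open>q\<close> so that it covers both \<open>x \<noteq> 0\<close>, with
  \<open>p = P(r, \<cdot>)\<close> and \<open>q = Q(r, \<cdot>)\<close>, and \<open>x = 0\<close>, with constants. The one-variable identity behind it is
  \<open>\<Phi>' = (n+1) p' + 2 q + (r\<^sup>2 - t\<^sup>2) q''\<close> for \<open>\<Phi> = (n+1) p + 2 t q + (r\<^sup>2 - t\<^sup>2) q'\<close>.\<close>

lemma E_curvature_of_spray:
  fixes x y :: "real^'n" and F :: "real^'n \<Rightarrow> real^'n \<Rightarrow> real"
  assumes "y \<noteq> 0" "open I" and I: "\<And>z. z \<noteq> 0 \<Longrightarrow> dir_comp x z \<in> I"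
    and p: "diff_times 2 I p" and q: "diff_times 3 I q"
    and G: "\<And>k z. z \<noteq> 0 \<Longrightarrow>
      spray F k x z = norm z * p (dir_comp x z) * z $ k + (norm z)\<^sup>2 * q (dir_comp x z) * x $ k"
  defines "s \<equiv> dir_comp x y" and "W \<equiv> (norm x)\<^sup>2 - (dir_comp x y)\<^sup>2" and "n \<equiv> real CARD('n)"
  shows "E_curvature F i j x y = 1/2 * (1 / norm y *
      (((n + 1) * (p s - s * deriv p s) + W * (deriv q s - s * deriv (deriv q) s))
          * ((if i = j then 1 else 0) - y $ i * y $ j / (norm y)\<^sup>2)
      + ((n + 1) * deriv (deriv p) s + 2 * deriv q s - 2 * s * deriv (deriv q) s
          + W * deriv (deriv (deriv q)) s)
          * (x $ i - s * y $ i / norm y) * (x $ j - s * y $ j / norm y)))"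
proof -
  note dp = diff_times_deriv[OF \<open>open I\<close> p[unfolded numeral_2_eq_2]]
  note dp' = diff_times_deriv[OF \<open>open I\<close> dp(1)]
  note dq = diff_times_deriv[OF \<open>open I\<close> q[unfolded numeral_3_eq_3]]
  note dq' = diff_times_deriv[OF \<open>open I\<close> dq(1)]
  note dq'' = diff_times_deriv[OF \<open>open I\<close> dq'(1)]
  define \<Phi> where "\<Phi> t = (n + 1) * p t + 2 * t * q t + ((norm x)\<^sup>2 - t\<^sup>2) * deriv q t" for t
  define \<Phi>' where "\<Phi>' t = (n + 1) * deriv p t + 2 * q t + ((norm x)\<^sup>2 - t\<^sup>2) * deriv (deriv q) t" for t
  define \<Phi>'' where "\<Phi>'' t = (n + 1) * deriv (deriv p) t + 2 * deriv q t - 2 * t * deriv (deriv q) t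
    + ((norm x)\<^sup>2 - t\<^sup>2) * deriv (deriv (deriv q)) t" for t
  have \<Phi>: "(\<Phi> has_real_derivative \<Phi>' t) (at t)" if "t \<in> I" for t
    unfolding \<Phi>_def[abs_def] \<Phi>'_def
    by (rule derivative_eq_intros dp(2) dq(2) dq'(2) that refl)+ (simp add: algebra_simps)
  have \<Phi>': "(\<Phi>' has_real_derivative \<Phi>'' t) (at t)" if "t \<in> I" for t
    unfolding \<Phi>'_def[abs_def] \<Phi>''_def
    by (rule derivative_eq_intros dp'(2) dq(2) dq''(2) that refl)+ (simp add: algebra_simps)
  have div: "(\<Sum>k\<in>UNIV. pd k (\<lambda>y. spray F k x y) z) = norm z * \<Phi> (dir_comp x z)" if "z \<noteq> 0" for z
    using divergence_deg2[OF that dp(2)[OF I] dq(2)[OF I], of "\<lambda>k. spray F k x"] that G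
    unfolding \<Phi>_def n_def by simp
  have "pd i (pd j (\<lambda>y. \<Sum>k\<in>UNIV. pd k (\<lambda>y. spray F k x y) y)) y
    = pd i (pd j (\<lambda>y. norm y * \<Phi> (dir_comp x y))) y"
    by (intro pd_cong[of "- {0}"]) (use assms(1) div in auto)
  also have "\<dots> = 1 / norm y * ((\<Phi> s - s * \<Phi>' s) * ((if i = j then 1 else 0) - y $ i * y $ j / (norm y)\<^sup>2)
      + \<Phi>'' s * (x $ i - s * y $ i / norm y) * (x $ j - s * y $ j / norm y))"
    unfolding s_def by (rule hessian_deg1) (use assms(1) I \<Phi> \<Phi>' in auto)
  also have "\<Phi> s - s * \<Phi>' s
     = (n + 1) * (p s - s * deriv p s) + W * (deriv q s - s * deriv (deriv q) s)"
    unfolding \<Phi>_def \<Phi>'_def W_def s_def by (simp add: algebra_simps power2_eq_square)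
  finally show ?thesis unfolding E_curvature_def \<Phi>''_def W_def s_def by simp
qed

section \<open>The fundamental tensor\<close>

text \<open>Up to a multiple of the identity the matrix has its range in the span of \<open>x\<close> and \<open>y\<close>, which makes
  it computable on vectors without coordinates.\<close>

lemma rank_update_mult_vec:
  fixes x y w :: "real^'n"
  shows "(\<chi> i j. 1/2 * (a * (if i = j then 1 else 0) + b * (x $ i * y $ j + y $ i * x $ j)
       - c * (y $ i * y $ j) + d * (x $ i * x $ j))) *v w
     = (1/2) *\<^sub>R (a *\<^sub>R w + (b * (y \<bullet> w) + d * (x \<bullet> w)) *\<^sub>R x + (b * (x \<bullet> w) - c * (y \<bullet> w)) *\<^sub>R y)"
proof -
  have "(\<Sum>j\<in>UNIV. 1/2 * (a * (if i = j then 1 else 0) + b * (x $ i * y $ j + y $ i * x $ j)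
       - c * (y $ i * y $ j) + d * (x $ i * x $ j)) * w $ j)
     = 1/2 * (a * w $ i + (b * (y \<bullet> w) + d * (x \<bullet> w)) * x $ i + (b * (x \<bullet> w) - c * (y \<bullet> w)) * y $ i)" for i
  proof -
    have "1/2 * (a * (if i = j then 1 else 0) + b * (x $ i * y $ j + y $ i * x $ j)
       - c * (y $ i * y $ j) + d * (x $ i * x $ j)) * w $ j
      = 1/2 * a * (if i = j then w $ j else 0) + (1/2 * (b * x $ i - c * y $ i)) * (y $ j * w $ j)
        + (1/2 * (b * y $ i + d * x $ i)) * (x $ j * w $ j)" for j
      by (simp add: algebra_simps)
    then have "(\<Sum>j\<in>UNIV. 1/2 * (a * (if i = j then 1 else 0) + b * (x $ i * y $ j + y $ i * x $ j)
       - c * (y $ i * y $ j) + d * (x $ i * x $ j)) * w $ j)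
      = 1/2 * a * (\<Sum>j\<in>UNIV. if i = j then w $ j else 0) + (1/2 * (b * x $ i - c * y $ i)) * (y \<bullet> w)
        + (1/2 * (b * y $ i + d * x $ i)) * (x \<bullet> w)"
      by (simp only: sum.distrib sum_inner flip: sum_distrib_left)
    then show ?thesis by (simp add: algebra_simps)
  qed
  then show ?thesis by (simp add: vec_eq_iff matrix_vector_mult_def)
qed

locale spherical_metric =
  fixes U :: "(real^'n) set" and F :: "real^'n \<Rightarrow> real^'n \<Rightarrow> real"
    and W :: "(real \<times> real) set" and \<psi> :: "real \<Rightarrow> real \<Rightarrow> real"
  assumes open_U: "open U"
    and finsler: "finsler_metric_on U F"
    and open_W: "open W"
    and dir_comp_in_W: "\<And>x y. x \<in> U \<Longrightarrow> y \<noteq> 0 \<Longrightarrow> (norm x, dir_comp x y) \<in> W"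
    and smooth_\<psi>: "smooth_on W (\<lambda>(r, s). \<psi> r s)"
    and \<psi>_pos: "\<And>r s. (r, s) \<in> W \<Longrightarrow> \<psi> r s > 0"
    and F_eq_nz: "\<And>x y. x \<in> U \<Longrightarrow> y \<noteq> 0 \<Longrightarrow> F x y = norm y * \<psi> (norm x) (dir_comp x y)"
begin

lemmas smooth_Ds = smooth_on_Ds[OF open_W smooth_\<psi>]
lemmas smooth_Dr = smooth_on_Dr[OF open_W smooth_\<psi>]
lemmas smooth_Dss = smooth_on_Ds[OF open_W smooth_Ds]
lemmas smooth_Drs = smooth_on_Ds[OF open_W smooth_Dr]
lemmas D\<psi> = smooth_on_DERIV_s[OF open_W smooth_\<psi>]
lemmas D\<psi>s = smooth_on_DERIV_s[OF open_W smooth_Ds]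
lemmas D\<psi>r = smooth_on_DERIV_s[OF open_W smooth_Dr]

lemma F_eq:
  assumes "x \<in> U" shows "F x y = norm y * \<psi> (norm x) (dir_comp x y)"
proof (cases "y = 0")
  case True
  have "F x (c *\<^sub>R z) = c * F x z" if "c > 0" for c z
    using finsler assms that unfolding finsler_metric_on_def by blast
  from this[of 2 0] show ?thesis using True by simp
qed (use assms F_eq_nz in auto)

abbreviation "\<psi>s \<equiv> Ds \<psi>"
abbreviation "\<psi>r \<equiv> Dr \<psi>"
abbreviation "\<psi>ss \<equiv> Ds (Ds \<psi>)"
abbreviation "\<psi>rs \<equiv> Ds (Dr \<psi>)"

text \<open>The geometry depends on \<open>F\<^sup>2 = u\<^sup>2 \<phi>(r, s)\<close>. The definitions that follow are \<open>\<phi>\<close> and its partial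
  derivatives, written out in those of \<open>\<psi>\<close>.\<close>

definition \<phi> where "\<phi> r s = (\<psi> r s)\<^sup>2"
definition \<phi>s where "\<phi>s r s = 2 * \<psi> r s * \<psi>s r s"
definition \<phi>ss where "\<phi>ss r s = 2 * (\<psi>s r s)\<^sup>2 + 2 * \<psi> r s * \<psi>ss r s"
definition \<phi>r where "\<phi>r r s = 2 * \<psi> r s * \<psi>r r s"
definition \<phi>rs where "\<phi>rs r s = 2 * \<psi>s r s * \<psi>r r s + 2 * \<psi> r s * \<psi>rs r s"

lemma D\<phi>: "(r, s) \<in> W \<Longrightarrow> (\<phi> r has_real_derivative \<phi>s r s) (at s)"
  unfolding \<phi>_def[abs_def] \<phi>s_def by (rule derivative_eq_intros D\<psi> refl | assumption)+ simp

lemma D\<phi>s: "(r, s) \<in> W \<Longrightarrow> (\<phi>s r has_real_derivative \<phi>ss r s) (at s)"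
  unfolding \<phi>s_def[abs_def] \<phi>ss_def
  by (rule derivative_eq_intros D\<psi> D\<psi>s refl | assumption)+ (simp add: power2_eq_square)

lemma D\<phi>r: "(r, s) \<in> W \<Longrightarrow> (\<phi>r r has_real_derivative \<phi>rs r s) (at s)"
  unfolding \<phi>r_def[abs_def] \<phi>rs_def
  by (rule derivative_eq_intros D\<psi> D\<psi>r refl | assumption)+ (simp add: mult_ac)

text \<open>Coefficients of \<open>2 g = A I + (B/u) (x y\<^sup>T + y x\<^sup>T) - (s B/u\<^sup>2) y y\<^sup>T + \<phi>\<^sub>s\<^sub>s x x\<^sup>T\<close>.\<close>

definition tensor_A where "tensor_A r s = 2 * \<phi> r s - s * \<phi>s r s"
definition tensor_B where "tensor_B r s = \<phi>s r s - s * \<phi>ss r s"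

lemma F_sq: "x \<in> U \<Longrightarrow> (F x y)\<^sup>2 = (norm y)\<^sup>2 * \<phi> (norm x) (dir_comp x y)"
  by (simp add: F_eq \<phi>_def power_mult_distrib)

lemma fund_tensor_mult_vec:
  assumes "x \<in> U" "y \<noteq> 0"
  defines "r \<equiv> norm x" and "s \<equiv> dir_comp x y" and "u \<equiv> norm y"
  shows "fund_tensor F x y *v w = (1/2) *\<^sub>R (tensor_A r s *\<^sub>R w
      + (tensor_B r s / u * (y \<bullet> w) + \<phi>ss r s * (x \<bullet> w)) *\<^sub>R x
      + (tensor_B r s / u * (x \<bullet> w) - s * tensor_B r s / u\<^sup>2 * (y \<bullet> w)) *\<^sub>R y)"
proof -
  have eq: "(\<lambda>y. (F x y)\<^sup>2) = (\<lambda>y. (norm y)\<^sup>2 * \<phi> r (dir_comp x y))"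
    using F_sq[OF assms(1)] by (auto simp: r_def)
  have "fund_tensor F x y = (\<chi> i j. 1/2 * (tensor_A r s * (if i = j then 1 else 0)
      + tensor_B r s / u * (x $ i * y $ j + y $ i * x $ j)
       - s * tensor_B r s / u\<^sup>2 * (y $ i * y $ j) + \<phi>ss r s * (x $ i * x $ j)))"
    unfolding fund_tensor_def eq
    by (subst hessian_deg2[where f = "\<phi> r" and f' = "\<phi>s r" and f'' = "\<phi>ss r s"])
      (use assms dir_comp_in_W D\<phi> D\<phi>s in \<open>auto simp: tensor_A_def tensor_B_def\<close>)
  then show ?thesis by (simp only: rank_update_mult_vec)
qed

lemma fund_tensor_pos: "x \<in> U \<Longrightarrow> y \<noteq> 0 \<Longrightarrow> w \<noteq> 0 \<Longrightarrow> w \<bullet> (fund_tensor F x y *v w) > 0"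
  using finsler unfolding finsler_metric_on_def by auto

text \<open>For independent \<open>x\<close> and \<open>y\<close> this is, up to positive factors, the determinant of \<open>g\<close> on the plane
  that they span; it is also the denominator of \<open>Q\<close>.\<close>

definition \<Delta> where "\<Delta> r s = \<psi> r s - s * \<psi>s r s + (r\<^sup>2 - s\<^sup>2) * \<psi>ss r s"

text \<open>Let \<open>v\<close> be the part of \<open>x\<close> orthogonal to \<open>y\<close>, so \<open>|v|\<^sup>2 = V = r\<^sup>2 - s\<^sup>2\<close>. If \<open>v \<noteq> 0\<close>, the vector
  \<open>w = v + l y\<close> that is \<open>g\<close>-orthogonal to \<open>y\<close> satisfies \<open>g(w, w) = \<psi> V \<Delta>\<close>. If \<open>v = 0\<close>, any nonzero
  vector orthogonal to \<open>y\<close> can be used, because \<open>g\<close> acts on it as \<open>\<psi> \<Delta>\<close>; such a vector exists only from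
  dimension two on.\<close>

lemma \<Delta>_pos:
  assumes x: "x \<in> U" and y: "y \<noteq> 0" and n: "CARD('n) \<ge> 2"
  shows "\<Delta> (norm x) (dir_comp x y) > 0"
proof -
  let ?r = "norm x" and ?s = "dir_comp x y" and ?u = "norm y"
  have u: "?u > 0" using y by simp
  have W: "(?r, ?s) \<in> W" using dir_comp_in_W x y by auto
  have \<psi>: "\<psi> ?r ?s > 0" using \<psi>_pos[OF W] .
  have xy: "x \<bullet> y = ?u * ?s" using inner_eq_norm_dir_comp[OF y] .
  have xx: "x \<bullet> x = ?r\<^sup>2" and yy: "y \<bullet> y = ?u\<^sup>2"
    by (simp_all add: power2_norm_eq_inner)
  have quad: "0 < tensor_A ?r ?s * (w \<bullet> w) + 2 * tensor_B ?r ?s / ?u * (y \<bullet> w) * (x \<bullet> w)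
      - ?s * tensor_B ?r ?s / ?u\<^sup>2 * (y \<bullet> w)\<^sup>2 + \<phi>ss ?r ?s * (x \<bullet> w)\<^sup>2" if "w \<noteq> 0" for w
  proof -
    have "w \<bullet> (fund_tensor F x y *v w) = 1/2 * (tensor_A ?r ?s * (w \<bullet> w) + 2 * tensor_B ?r ?s / ?u * (y \<bullet> w) * (x \<bullet> w)
      - ?s * tensor_B ?r ?s / ?u\<^sup>2 * (y \<bullet> w)\<^sup>2 + \<phi>ss ?r ?s * (x \<bullet> w)\<^sup>2)"
      unfolding fund_tensor_mult_vec[OF x y] inner_add_right inner_scaleR_right
        inner_commute[of w x] inner_commute[of w y]
      by (simp add: algebra_simps power2_eq_square)
    then show ?thesis using fund_tensor_pos[OF x y that] by simp
  qed
  define V where "V = ?r\<^sup>2 - ?s\<^sup>2"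
  define v where "v = x - (?s / ?u) *\<^sub>R y"
  have vv: "v \<bullet> v = V" "x \<bullet> v = V" "y \<bullet> v = 0"
    using u unfolding v_def V_def inner_diff_left inner_diff_right inner_scaleR_left inner_scaleR_right
      inner_commute[of y x] xy xx yy
    by (simp_all add: field_simps power2_eq_square)
  show ?thesis
  proof (cases "v = 0")
    case False
    then have V: "V > 0" using vv(1) inner_gt_zero_iff[of v] by auto
    \<comment> \<open>The minimiser of the quadratic form \<open>g\<close> on the line \<open>v + l y\<close>.\<close>
    define l where "l = - (\<psi>s ?r ?s * V) / (\<psi> ?r ?s * ?u)"
    define w where "w = v + l *\<^sub>R y"
    have ww: "w \<bullet> w = V + l\<^sup>2 * ?u\<^sup>2" "y \<bullet> w = l * ?u\<^sup>2" "x \<bullet> w = V + l * ?u * ?s"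
      unfolding w_def using vv
      by (simp_all add: inner_add inner_commute[of v y] xy yy power2_eq_square)
    have "w \<noteq> 0"
    proof
      assume "w = 0"
      then have "v \<bullet> w = 0" by simp
      then show False using V vv unfolding w_def by (simp add: inner_add inner_commute[of v y])
    qed
    note quad[OF this, unfolded ww]
    also have "tensor_A ?r ?s * (V + l\<^sup>2 * ?u\<^sup>2) + 2 * tensor_B ?r ?s / ?u * (l * ?u\<^sup>2) * (V + l * ?u * ?s)
      - ?s * tensor_B ?r ?s / ?u\<^sup>2 * (l * ?u\<^sup>2)\<^sup>2 + \<phi>ss ?r ?s * (V + l * ?u * ?s)\<^sup>2
      = 2 * \<psi> ?r ?s * V * \<Delta> ?r ?s"
    proof -
      define m where "m = l * ?u"
      have m: "m = - (\<psi>s ?r ?s * V) / \<psi> ?r ?s" using u unfolding m_def l_def by simp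
      have "tensor_A ?r ?s * (V + l\<^sup>2 * ?u\<^sup>2) + 2 * tensor_B ?r ?s / ?u * (l * ?u\<^sup>2) * (V + l * ?u * ?s)
        - ?s * tensor_B ?r ?s / ?u\<^sup>2 * (l * ?u\<^sup>2)\<^sup>2 + \<phi>ss ?r ?s * (V + l * ?u * ?s)\<^sup>2
        = tensor_A ?r ?s * (V + m\<^sup>2) + 2 * tensor_B ?r ?s * m * (V + m * ?s) - ?s * tensor_B ?r ?s * m\<^sup>2
          + \<phi>ss ?r ?s * (V + m * ?s)\<^sup>2"
        using u unfolding m_def by (simp add: power2_eq_square)
      also have "\<dots> = 2 * \<psi> ?r ?s * V * \<Delta> ?r ?s"
        using \<psi> unfolding m tensor_A_def tensor_B_def \<phi>_def \<phi>s_def \<phi>ss_def \<Delta>_def V_def[symmetric]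
        by (simp add: divide_simps) (simp add: algebra_simps power2_eq_square)
      finally show ?thesis .
    qed
    finally show ?thesis by (rule zero_less_mult_pos) (use \<psi> V in simp)
  next
    case True
    obtain b :: "real^'n" where b: "b \<noteq> 0" "y \<bullet> b = 0"
      using orthogonal_to_vector_exists[of y] n unfolding orthogonal_def by auto
    have x: "x = (?s / ?u) *\<^sub>R y" using True unfolding v_def by simp
    have "x \<bullet> b = 0" by (subst x) (simp add: b(2))
    with quad[OF b(1)] b have "tensor_A ?r ?s * (b \<bullet> b) > 0" by simp
    then have "tensor_A ?r ?s > 0" by (rule zero_less_mult_pos2) (use b(1) in simp)
    moreover have "tensor_A ?r ?s = 2 * \<psi> ?r ?s * (\<psi> ?r ?s - ?s * \<psi>s ?r ?s)"
      unfolding tensor_A_def \<phi>_def \<phi>s_def by (simp add: algebra_simps power2_eq_square)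
    moreover have "V = 0" using True vv(1) by simp
    ultimately show ?thesis using \<psi> unfolding \<Delta>_def V_def[symmetric] by (simp add: zero_less_mult_iff)
  qed
qed

section \<open>The spray\<close>

text \<open>Positivity makes \<open>g\<close> invertible, so a candidate for the spray can be verified by applying \<open>g\<close> to it.\<close>

lemma spray_eqI:
  assumes x: "x \<in> U" and y: "y \<noteq> 0"
    and G: "\<And>l. (\<Sum>k\<in>UNIV. pd l (\<lambda>y'. pd k (\<lambda>x'. (F x' y')\<^sup>2) x) y * y $ k)
        - pd l (\<lambda>x'. (F x' y)\<^sup>2) x = 4 * (fund_tensor F x y *v G) $ l"
  shows "spray F i x y = G $ i"
proof -
  let ?g = "fund_tensor F x y"
  have "w = 0" if "?g *v w = 0" for w
    using fund_tensor_pos[OF x y, of w] that by auto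
  then have "invertible ?g"
    by (simp add: invertible_left_inverse matrix_left_invertible_ker)
  then have "\<exists>M. ?g ** M = mat 1 \<and> M ** ?g = mat 1"
    unfolding invertible_def .
  then have "matrix_inv ?g ** ?g = mat 1"
    unfolding matrix_inv_def by (rule someI2_ex) simp
  then have "matrix_inv ?g *v (?g *v G) = G"
    by (simp add: matrix_vector_mul_assoc)
  then have "(matrix_inv ?g *v (?g *v G)) $ i = G $ i" by (rule arg_cong)
  then have "(\<Sum>l\<in>UNIV. matrix_inv ?g $ i $ l * (?g *v G) $ l) = G $ i"
    unfolding matrix_vector_mult_def[of "matrix_inv ?g"] by simp
  then show ?thesis unfolding spray_def G
    by (simp add: mult.left_commute flip: sum_distrib_left)
qed

lemma has_pd_F_sq_base:
  assumes x: "x \<in> U" "x \<noteq> 0" and y: "y \<noteq> 0"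
  defines "r \<equiv> norm x" and "s \<equiv> dir_comp x y" and "u \<equiv> norm y"
  shows "has_pd k (\<lambda>x'. (F x' y)\<^sup>2) (u\<^sup>2 * \<phi>r r s * (x $ k / r) + u * \<phi>s r s * y $ k) x"
proof -
  have u: "u > 0" using y by (simp add: u_def)
  have W: "(r, s) \<in> W" using dir_comp_in_W x y unfolding r_def s_def by auto
  have s: "has_pd k (\<lambda>x'. dir_comp x' y) (y $ k / u) x"
    using has_pd_mult[OF has_pd_inner[of k y x] has_pd_const[of k "inverse u"]]
    by (simp add: dir_comp_def[abs_def] u_def divide_inverse inner_commute)
  have \<psi>: "has_pd k (\<lambda>x'. \<psi> (norm x') (dir_comp x' y)) (x $ k / r * \<psi>r r s + y $ k / u * \<psi>s r s) x"
    unfolding r_def by (rule has_pd_chain2[OF _ has_pd_norm[OF x(2)] s])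
      (use smooth_on_has_derivative[OF open_W smooth_\<psi> W] in \<open>simp add: r_def s_def\<close>)
  note c = has_pd_mult[OF has_pd_const[of k u] \<psi>]
  have "has_pd k (\<lambda>x'. (u * \<psi> (norm x') (dir_comp x' y)) * (u * \<psi> (norm x') (dir_comp x' y)))
    (u\<^sup>2 * \<phi>r r s * (x $ k / r) + u * \<phi>s r s * y $ k) x"
    by (rule has_pd_eq[OF has_pd_mult[OF c c]])
      (use u in \<open>simp add: \<phi>r_def \<phi>s_def r_def[symmetric] s_def[symmetric] field_simps power2_eq_square\<close>)
  then show ?thesis
    by (rule has_pd_cong[OF _ open_U x(1)]) (simp add: F_eq u_def power2_eq_square)
qed

lemma spray_numerator:
  assumes x: "x \<in> U" "x \<noteq> 0" and y: "y \<noteq> 0"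
  defines "r \<equiv> norm x" and "s \<equiv> dir_comp x y" and "u \<equiv> norm y"
  shows "(\<Sum>k\<in>UNIV. pd l (\<lambda>y'. pd k (\<lambda>x'. (F x' y')\<^sup>2) x) y * y $ k) - pd l (\<lambda>x'. (F x' y)\<^sup>2) x
     = u * y $ l * (s / r * (2 * \<phi>r r s - s * \<phi>rs r s) + \<phi>s r s - s * \<phi>ss r s)
     + u\<^sup>2 * x $ l * (s / r * \<phi>rs r s + \<phi>ss r s - \<phi>r r s / r)"
proof -
  have u: "u > 0" using y by (simp add: u_def)
  have r: "r > 0" using x by (simp add: r_def)
  have W: "(r, s) \<in> W" using dir_comp_in_W x y unfolding r_def s_def by auto
  have "pd l (\<lambda>y'. pd k (\<lambda>x'. (F x' y')\<^sup>2) x) y * y $ k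
    = (2 * y $ l * \<phi>r r s + u * \<phi>rs r s * (x $ l - s * y $ l / u)) / r * (x $ k * y $ k)
      + \<phi>s r s * u * (if l = k then y $ k else 0)
      + (\<phi>s r s * y $ l / u + \<phi>ss r s * (x $ l - s * y $ l / u)) * (y $ k * y $ k)" for k
  proof -
    note s = has_pd_dir_comp[OF y, of l x]
    note n = has_pd_norm[OF y, of l]
    note d1 = has_pd_chain[OF D\<phi>r[OF W, unfolded s_def] s]
    note d2 = has_pd_chain[OF D\<phi>s[OF W, unfolded s_def] s]
    have "has_pd l (\<lambda>y'. norm y' * norm y' * \<phi>r r (dir_comp x y') * (x $ k / r) + norm y' * \<phi>s r (dir_comp x y') * y' $ k)
      ((2 * y $ l * \<phi>r r s + u * \<phi>rs r s * (x $ l - s * y $ l / u)) / r * x $ k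
      + \<phi>s r s * u * (if l = k then 1 else 0)
      + (\<phi>s r s * y $ l / u + \<phi>ss r s * (x $ l - s * y $ l / u)) * y $ k) y"
      by (rule has_pd_eq[OF has_pd_add[OF
            has_pd_mult[OF has_pd_mult[OF has_pd_mult[OF n n] d1] has_pd_const]
            has_pd_mult[OF has_pd_mult[OF n d2] has_pd_component]]])
        (use u r in \<open>simp add: s_def[symmetric] u_def[symmetric] field_simps power2_eq_square\<close>)
    then have "has_pd l (\<lambda>y'. pd k (\<lambda>x'. (F x' y')\<^sup>2) x)
      ((2 * y $ l * \<phi>r r s + u * \<phi>rs r s * (x $ l - s * y $ l / u)) / r * x $ k
      + \<phi>s r s * u * (if l = k then 1 else 0)
      + (\<phi>s r s * y $ l / u + \<phi>ss r s * (x $ l - s * y $ l / u)) * y $ k) y"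
      by (rule has_pd_cong[of _ _ _ _ "- {0}"])
        (use y has_pd_imp_pd[OF has_pd_F_sq_base[OF x]] in \<open>auto simp: r_def power2_eq_square\<close>)
    then show ?thesis by (subst has_pd_imp_pd) (assumption, simp add: algebra_simps)
  qed
  then have "(\<Sum>k\<in>UNIV. pd l (\<lambda>y'. pd k (\<lambda>x'. (F x' y')\<^sup>2) x) y * y $ k)
    = (2 * y $ l * \<phi>r r s + u * \<phi>rs r s * (x $ l - s * y $ l / u)) / r * (x \<bullet> y)
      + \<phi>s r s * u * (\<Sum>k\<in>UNIV. if l = k then y $ k else 0)
      + (\<phi>s r s * y $ l / u + \<phi>ss r s * (x $ l - s * y $ l / u)) * u\<^sup>2"
    by (simp only: sum.distrib sum_inner power2_norm_eq_inner u_def flip: sum_distrib_left)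
  also have "x \<bullet> y = u * s" using inner_eq_norm_dir_comp[OF y] unfolding u_def s_def .
  also have "(\<Sum>k\<in>UNIV. if l = k then y $ k else 0) = y $ l" by simp
  finally have sum: "(\<Sum>k\<in>UNIV. pd l (\<lambda>y'. pd k (\<lambda>x'. (F x' y')\<^sup>2) x) y * y $ k)
    = (2 * y $ l * \<phi>r r s + u * \<phi>rs r s * (x $ l - s * y $ l / u)) / r * (u * s)
      + \<phi>s r s * u * y $ l + (\<phi>s r s * y $ l / u + \<phi>ss r s * (x $ l - s * y $ l / u)) * u\<^sup>2" .
  show ?thesis
    unfolding sum has_pd_imp_pd[OF has_pd_F_sq_base[OF x y]] r_def[symmetric] s_def[symmetric] u_def[symmetric]
    using r u by (simp add: field_simps power2_eq_square)
qed

text \<open>Here \<open>a, b, c, d, e\<close> stand for \<open>\<psi>, \<psi>\<^sub>s, \<psi>\<^sub>s\<^sub>s, \<psi>\<^sub>r, \<psi>\<^sub>r\<^sub>s\<close>, and the hypotheses are the definitions of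
  \<open>P\<close> and \<open>Q\<close> cleared of denominators.\<close>

lemma PQ_algebra:
  fixes a b c d e r s P Q :: real
  assumes Q: "2 * r * (a - s * b + (r\<^sup>2 - s\<^sup>2) * c) * Q = r * c + s * e - d"
    and P: "2 * r * a * P = s * d + r * b - 2 * r * (s * a + (r\<^sup>2 - s\<^sup>2) * b) * Q"
  shows "2 * r * ((2 * a\<^sup>2 - s * (2 * a * b)) * P + (2 * a * b - s * (2 * b\<^sup>2 + 2 * a * c)) * (r\<^sup>2 - s\<^sup>2) * Q)
      = s * (2 * (2 * a * d) - s * (2 * b * d + 2 * a * e)) + r * (2 * a * b - s * (2 * b\<^sup>2 + 2 * a * c))"
    and "2 * r * (2 * a * b * P + (2 * a\<^sup>2 - s * (2 * a * b) + (2 * a * b - s * (2 * b\<^sup>2 + 2 * a * c)) * s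
          + (2 * b\<^sup>2 + 2 * a * c) * r\<^sup>2) * Q)
      = s * (2 * b * d + 2 * a * e) + r * (2 * b\<^sup>2 + 2 * a * c) - 2 * a * d"
  using assms by algebra+

text \<open>The coefficients of \<open>u y\<close> and \<open>u\<^sup>2 x\<close> in the equation \<open>4 g (u P y + u\<^sup>2 Q x) = b\<close>, with \<open>b\<close> the
  bracket of \<open>spray_numerator\<close>.\<close>

lemma PQ_equations:
  assumes "r \<noteq> 0" "\<psi> r s \<noteq> 0" "\<Delta> r s \<noteq> 0"
  defines "P \<equiv> P_formula \<psi> r s" and "Q \<equiv> Q_formula \<psi> r s"
  shows "2 * (tensor_A r s * P + tensor_B r s * (r\<^sup>2 - s\<^sup>2) * Q) = s / r * (2 * \<phi>r r s - s * \<phi>rs r s) + \<phi>s r s - s * \<phi>ss r s"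
    and "2 * (\<phi>s r s * P + (tensor_A r s + tensor_B r s * s + \<phi>ss r s * r\<^sup>2) * Q) = s / r * \<phi>rs r s + \<phi>ss r s - \<phi>r r s / r"
proof -
  have Q: "2 * r * (\<psi> r s - s * \<psi>s r s + (r\<^sup>2 - s\<^sup>2) * \<psi>ss r s) * Q = r * \<psi>ss r s + s * \<psi>rs r s - \<psi>r r s"
    using assms(1,3) unfolding Q_def Q_formula_def \<Delta>_def by simp
  have P: "2 * r * \<psi> r s * P = s * \<psi>r r s + r * \<psi>s r s - 2 * r * (s * \<psi> r s + (r\<^sup>2 - s\<^sup>2) * \<psi>s r s) * Q"
    using assms(1,2) unfolding P_def P_formula_def Q_def[symmetric] by (simp add: right_diff_distrib)
  note PQ_algebra[OF Q P, folded \<phi>_def \<phi>s_def \<phi>r_def \<phi>rs_def \<phi>ss_def]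
  note E = this[folded \<phi>_def tensor_A_def tensor_B_def]
  \<comment> \<open>Both identities come multiplied by \<open>r\<close>.\<close>
  have cancel: "2 * X = Y / r" if "2 * r * X = Y" for X Y
    using that assms(1) by (simp add: field_simps)
  show "2 * (tensor_A r s * P + tensor_B r s * (r\<^sup>2 - s\<^sup>2) * Q) = s / r * (2 * \<phi>r r s - s * \<phi>rs r s) + \<phi>s r s - s * \<phi>ss r s"
    unfolding cancel[OF E(1)] using assms(1) by (simp add: tensor_B_def field_simps)
  show "2 * (\<phi>s r s * P + (tensor_A r s + tensor_B r s * s + \<phi>ss r s * r\<^sup>2) * Q) = s / r * \<phi>rs r s + \<phi>ss r s - \<phi>r r s / r"
    unfolding cancel[OF E(2)] using assms(1) by (simp add: field_simps)
qed

lemma spray_eq: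
  assumes x: "x \<in> U" "x \<noteq> 0" and y: "y \<noteq> 0" and n: "CARD('n) \<ge> 2"
  defines "r \<equiv> norm x" and "s \<equiv> dir_comp x y" and "u \<equiv> norm y"
  shows "spray F i x y = u * P_formula \<psi> r s * y $ i + u\<^sup>2 * Q_formula \<psi> r s * x $ i"
proof -
  have u: "u > 0" using y by (simp add: u_def)
  have r: "r > 0" using x by (simp add: r_def)
  have W: "(r, s) \<in> W" using dir_comp_in_W x y unfolding r_def s_def by auto
  have \<psi>: "\<psi> r s > 0" using \<psi>_pos[OF W] .
  have \<Delta>: "\<Delta> r s > 0" using \<Delta>_pos[OF x(1) y n] unfolding r_def s_def .
  define P where "P = P_formula \<psi> r s"
  define Q where "Q = Q_formula \<psi> r s"
  note PQ = PQ_equations[of r s, folded P_def Q_def]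
  define G where "G = (u * P) *\<^sub>R y + (u\<^sup>2 * Q) *\<^sub>R x"
  have i: "x \<bullet> y = u * s" "y \<bullet> x = u * s" "y \<bullet> y = u\<^sup>2" "x \<bullet> x = r\<^sup>2"
    using inner_eq_norm_dir_comp[OF y, of x]
    by (simp_all add: u_def r_def s_def power2_norm_eq_inner inner_commute)
  have "spray F i x y = G $ i"
  proof (rule spray_eqI[OF x(1) y])
    fix l
    have "4 * (fund_tensor F x y *v G) $ l =
      u * y $ l * (2 * (tensor_A r s * P + tensor_B r s * (r\<^sup>2 - s\<^sup>2) * Q))
      + u\<^sup>2 * x $ l * (2 * (\<phi>s r s * P + (tensor_A r s + tensor_B r s * s + \<phi>ss r s * r\<^sup>2) * Q))"
      unfolding fund_tensor_mult_vec[OF x(1) y] r_def[symmetric] s_def[symmetric] u_def[symmetric]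
      \<comment> \<open>By \<open>B + s \<phi>\<^sub>s\<^sub>s = \<phi>\<^sub>s\<close>, the coefficient of \<open>P\<close> along \<open>x\<close> is \<open>\<phi>\<^sub>s\<close>.\<close>
      unfolding G_def inner_add_right inner_scaleR_right i
      using u by (simp add: tensor_B_def field_simps power2_eq_square)
    then show "(\<Sum>k\<in>UNIV. pd l (\<lambda>y'. pd k (\<lambda>x'. (F x' y')\<^sup>2) x) y * y $ k)
        - pd l (\<lambda>x'. (F x' y)\<^sup>2) x = 4 * (fund_tensor F x y *v G) $ l"
      unfolding spray_numerator[OF x y] r_def[symmetric] s_def[symmetric] u_def[symmetric]
      using PQ r \<psi> \<Delta> by simp
  qed
  then show ?thesis by (simp add: G_def P_def Q_def)
qed

end

context spherical_metric
begin

text \<open>The set of \<open>s\<close> with \<open>\<Delta> \<noteq> 0\<close> is open and, by \<open>\<Delta>_pos\<close>, contains all values that \<open>s\<close> takes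
  at a point of \<open>U\<close> in dimension at least two. Openness
  matters at \<open>s = r\<close> and \<open>s = - r\<close>, where the derivatives in \<open>s\<close> use values that belong to no direction \<open>y\<close>.\<close>

lemma spray_coeffs_smooth:
  assumes "r \<noteq> 0"
  defines "I \<equiv> {s. (r, s) \<in> W \<and> \<Delta> r s \<noteq> 0}"
  shows "open I" and "diff_times k I (spray_P \<psi> r)" and "diff_times k I (spray_Q \<psi> r)"
proof -
  let ?S = "{s. (r, s) \<in> W}"
  have S: "open ?S" using open_slice[OF open_W] .
  note sl = smooth_on_slice[OF open_W smooth_\<psi>, of _ r] smooth_on_slice[OF open_W smooth_Ds, of _ r]
    smooth_on_slice[OF open_W smooth_Dss, of _ r] smooth_on_slice[OF open_W smooth_Dr, of _ r]
    smooth_on_slice[OF open_W smooth_Drs, of _ r]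
  note intros = diff_times_add diff_times_diff diff_times_mult diff_times_const diff_times_ident sl
  have \<Delta>: "diff_times m ?S (\<Delta> r)" for m
    unfolding \<Delta>_def[abs_def] power2_eq_square by (intro intros)
  have "continuous_on ?S (\<Delta> r)"
    using diff_times_deriv(2)[OF S \<Delta>] DERIV_isCont
    by (auto intro!: continuous_at_imp_continuous_on)
  from continuous_open_preimage[OF this S open_Compl[OF closed_singleton[of 0]]]
  show I: "open I" unfolding I_def by (simp add: vimage_def Int_def)
  have sub: "I \<subseteq> ?S" unfolding I_def by auto
  note slI = sl[THEN diff_times_subset[OF sub]]
  note intrI = diff_times_add diff_times_diff diff_times_mult diff_times_divide
    diff_times_const diff_times_ident slI
  have Q: "diff_times k I (Q_formula \<psi> r)"
    unfolding Q_formula_def[abs_def] power2_eq_square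
    by (intro intrI) (use assms(1) in \<open>auto simp: I_def \<Delta>_def power2_eq_square\<close>)
  then show "diff_times k I (spray_Q \<psi> r)"
    using assms(1) by (simp add: spray_Q_def[abs_def])
  have "diff_times k I (P_formula \<psi> r)"
    unfolding P_formula_def[abs_def] power2_eq_square
    by (intro intrI Q) (use assms(1) \<psi>_pos in \<open>auto simp: I_def less_imp_neq[symmetric]\<close>)
  then show "diff_times k I (spray_P \<psi> r)"
    using assms(1) by (simp add: spray_P_def[abs_def])
qed

section \<open>The metric at the origin\<close>

text \<open>This comes from the joint smoothness of \<open>F\<close> and not from its representation by \<open>\<psi>\<close>, so it includes
  the origin, where the norm is not differentiable.\<close>

lemma F_differentiable_base:
  assumes "x \<in> U" "y \<noteq> 0"
  shows "(\<lambda>x. F x y) differentiable (at x)"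
proof -
  have "Ck_on (Suc 0) (U \<times> - {0}) (\<lambda>(x, y). F x y)"
    using finsler unfolding finsler_metric_on_def smooth_on_def by blast
  then have "(\<lambda>(x, y). F x y) differentiable (at (x, y))"
    using assms by simp
  then obtain D where D: "((\<lambda>(x, y). F x y) has_derivative D) (at (x, y))"
    unfolding differentiable_def by blast
  have "((\<lambda>x. (\<lambda>(x, y). F x y) (x, y)) has_derivative (\<lambda>h. D (h, 0))) (at x)"
    by (rule has_derivative_compose[where f="\<lambda>x. (x, y)", OF _ D])
      (auto intro!: derivative_eq_intros)
  then show ?thesis unfolding differentiable_def by auto
qed

lemma has_pd_F_base:
  assumes "x \<in> U" "y \<noteq> 0"
  obtains d where "has_pd k (\<lambda>x. F x y) d x"
  using F_differentiable_base[OF assms] has_pd_has_derivative unfolding differentiable_def by blast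

text \<open>On the \<open>k\<close>-th axis \<open>F(t e\<^sub>k, y) = u \<psi>(|t|, t c)\<close> with \<open>c = y\<^sup>k/u\<close>. Its one-sided derivatives at
  \<open>t = 0\<close> are \<open>u (c \<psi>\<^sub>s + \<psi>\<^sub>r)\<close> and \<open>u (c \<psi>\<^sub>s - \<psi>\<^sub>r)\<close>; differentiability of \<open>F\<close> makes them equal, so
  \<open>\<psi>\<^sub>r(0, 0) = 0\<close>.\<close>

lemma has_pd_F_origin:
  assumes x: "0 \<in> U" and y: "y \<noteq> 0"
  shows "has_pd k (\<lambda>x. F x y) (\<psi>s 0 0 * y $ k) 0"
proof -
  obtain d where d: "has_pd k (\<lambda>x. F x y) d 0" using has_pd_F_base[OF x y] .
  let ?u = "norm y" and ?e = "axis k 1 :: real^'n"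
  have u: "?u > 0" using y by simp
  have W: "(0, 0) \<in> W" using dir_comp_in_W[OF x y] by (simp add: dir_comp_def)
  define c where "c = y $ k / ?u"
  let ?l = "\<lambda>t::real. 0 + t *\<^sub>R ?e"
  have "open (?l -` U)" by (rule open_vimage) (auto intro!: continuous_intros open_U)
  moreover have "0 \<in> ?l -` U" using x by simp
  ultimately have T: "open (?l -` U)" "0 \<in> ?l -` U" .
  have F: "F (?l t) y = ?u * \<psi> \<bar>t\<bar> (t * c)" if "t \<in> ?l -` U" for t
    using F_eq[of "?l t" y] that by (simp add: dir_comp_def c_def inner_axis' norm_axis_1)
  have h: "((\<lambda>t. ?u * \<psi> (\<sigma> * t) (t * c)) has_real_derivative ?u * (\<sigma> * \<psi>r 0 0 + c * \<psi>s 0 0)) (at 0)" for \<sigma>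
  proof -
    have *: "((\<lambda>t::real. (\<sigma> * t, t * c)) has_derivative (\<lambda>t. (\<sigma> * t, t * c))) (at 0)"
      by (auto intro!: derivative_eq_intros)
    have "((\<lambda>(r, s). \<psi> r s) has_derivative (\<lambda>(a, b). a * \<psi>r 0 0 + b * \<psi>s 0 0)) (at (\<sigma> * 0, 0 * c))"
      using smooth_on_has_derivative[OF open_W smooth_\<psi> W] by simp
    from has_derivative_compose[OF * this]
    have "((\<lambda>t. \<psi> (\<sigma> * t) (t * c)) has_derivative (\<lambda>t. \<sigma> * t * \<psi>r 0 0 + t * c * \<psi>s 0 0)) (at 0)"
      by simp
    moreover have "(\<lambda>t. \<sigma> * t * \<psi>r 0 0 + t * c * \<psi>s 0 0) = (*) (\<sigma> * \<psi>r 0 0 + c * \<psi>s 0 0)"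
      by (auto simp: algebra_simps)
    ultimately have "((\<lambda>t. \<psi> (\<sigma> * t) (t * c)) has_real_derivative \<sigma> * \<psi>r 0 0 + c * \<psi>s 0 0) (at 0)"
      by (simp add: has_field_derivative_def)
    from DERIV_cmult[OF this, of ?u] show ?thesis .
  qed
  \<comment> \<open>The sign \<open>\<sigma>\<close> is \<open>1\<close> on the right half line and \<open>- 1\<close> on the left one.\<close>
  have one_sided: "d = ?u * (\<sigma> * \<psi>r 0 0 + c * \<psi>s 0 0)"
    if "\<And>t. t \<in> S \<Longrightarrow> \<bar>t\<bar> = \<sigma> * t" "0 \<in> S" "at 0 within S \<noteq> bot" for \<sigma> S
  proof (rule has_field_derivative_unique)
    show "((\<lambda>t. F (?l t) y) has_real_derivative d) (at 0 within S)"
      using d unfolding has_pd_def by (rule has_field_derivative_at_within)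
    have ev: "\<forall>\<^sub>F t in at 0 within S. F (?l t) y = ?u * \<psi> (\<sigma> * t) (t * c)"
      using T that(1) F unfolding eventually_at_topological by (metis (no_types, lifting))
    show "((\<lambda>t. F (?l t) y) has_real_derivative ?u * (\<sigma> * \<psi>r 0 0 + c * \<psi>s 0 0)) (at 0 within S)"
      using has_field_derivative_at_within[OF h, of \<sigma> S]
      by (subst has_field_derivative_cong_eventually[OF ev]) (use F[of 0] x in auto)
  qed (rule that(3))
  have right: "d = ?u * (1 * \<psi>r 0 0 + c * \<psi>s 0 0)"
    by (rule one_sided[of "{0..}"]) (auto simp: at_within_Ici_at_right)
  have left: "d = ?u * (- 1 * \<psi>r 0 0 + c * \<psi>s 0 0)"
    by (rule one_sided[of "{..0}"]) (auto simp: at_within_Iic_at_left)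
  have "?u * \<psi>r 0 0 = 0" using right left by (simp only: distrib_left)
  then have "d = ?u * (c * \<psi>s 0 0)" using right by (simp add: distrib_left)
  then have "d = \<psi>s 0 0 * y $ k" using u by (simp add: c_def)
  with d show ?thesis by simp
qed

lemma dir_comp_zero [simp]: "dir_comp 0 y = 0"
  by (simp add: dir_comp_def)

text \<open>At the origin \<open>g = \<psi>\<^sup>2 I\<close>, and \<open>\<partial>F\<^sup>2/\<partial>x\<^sup>k = u \<phi>\<^sub>s y\<^sup>k\<close> as a function of \<open>y\<close>.\<close>

lemma spray_origin:
  assumes x: "0 \<in> U" and y: "y \<noteq> 0"
  shows "spray F i 0 y = norm y * (\<psi>s 0 0 / (2 * \<psi> 0 0)) * y $ i"
proof -
  let ?u = "norm y"
  have u: "?u > 0" using y by simp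
  have W: "(0, 0) \<in> W" using dir_comp_in_W[OF x y] by simp
  have \<psi>: "\<psi> 0 0 > 0" using \<psi>_pos[OF W] .
  have base: "has_pd k (\<lambda>x. (F x z)\<^sup>2) (norm z * \<phi>s 0 0 * z $ k) 0" if "z \<noteq> 0" for k z
  proof -
    note d = has_pd_F_origin[OF x that, of k]
    show ?thesis unfolding power2_eq_square
      by (rule has_pd_eq[OF has_pd_mult[OF d d]]) (simp add: F_eq[OF x] \<phi>s_def)
  qed
  have mixed: "pd l (\<lambda>y'. pd k (\<lambda>x'. (F x' y')\<^sup>2) 0) y * y $ k
      = \<phi>s 0 0 * y $ l / ?u * (y $ k * y $ k) + \<phi>s 0 0 * ?u * (if l = k then y $ k else 0)" for k l
  proof -
    have "has_pd l (\<lambda>y'. norm y' * \<phi>s 0 0 * y' $ k)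
       (\<phi>s 0 0 * y $ l / ?u * y $ k + \<phi>s 0 0 * ?u * (if l = k then 1 else 0)) y"
      by (rule has_pd_eq[OF has_pd_mult[OF has_pd_mult[OF has_pd_norm[OF y] has_pd_const] has_pd_component]])
        simp
    then have "has_pd l (\<lambda>y'. pd k (\<lambda>x'. (F x' y')\<^sup>2) 0)
       (\<phi>s 0 0 * y $ l / ?u * y $ k + \<phi>s 0 0 * ?u * (if l = k then 1 else 0)) y"
      by (rule has_pd_cong[of _ _ _ _ "- {0}"]) (use y has_pd_imp_pd[OF base] in auto)
    then show ?thesis by (subst has_pd_imp_pd) (assumption, simp add: algebra_simps)
  qed
  define G where "G = (?u * (\<psi>s 0 0 / (2 * \<psi> 0 0))) *\<^sub>R y"
  have "spray F i 0 y = G $ i"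
  proof (rule spray_eqI[OF x y])
    fix l
    have "(\<Sum>k\<in>UNIV. pd l (\<lambda>y'. pd k (\<lambda>x'. (F x' y')\<^sup>2) 0) y * y $ k)
       = \<phi>s 0 0 * y $ l / ?u * (y \<bullet> y) + \<phi>s 0 0 * ?u * (\<Sum>k\<in>UNIV. if l = k then y $ k else 0)"
      by (simp only: mixed sum.distrib sum_inner flip: sum_distrib_left)
    also have "\<dots> = 2 * ?u * \<phi>s 0 0 * y $ l"
      using u by (simp add: power2_norm_eq_inner[symmetric] power2_eq_square)
    finally have sum: "(\<Sum>k\<in>UNIV. pd l (\<lambda>y'. pd k (\<lambda>x'. (F x' y')\<^sup>2) 0) y * y $ k)
       = 2 * ?u * \<phi>s 0 0 * y $ l" .
    show "(\<Sum>k\<in>UNIV. pd l (\<lambda>y'. pd k (\<lambda>x'. (F x' y')\<^sup>2) 0) y * y $ k)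
        - pd l (\<lambda>x'. (F x' y)\<^sup>2) 0 = 4 * (fund_tensor F 0 y *v G) $ l"
      unfolding sum has_pd_imp_pd[OF base[OF y]] fund_tensor_mult_vec[OF x y]
      using \<psi> by (simp add: G_def tensor_A_def \<phi>_def \<phi>s_def power2_eq_square)
  qed
  then show ?thesis by (simp add: G_def)
qed

text \<open>In \<open>P(r, 0)\<close> the term with \<open>Q\<close> carries the factor \<open>r\<^sup>2\<close>, while \<open>Q\<close> is at most of order \<open>1/r\<close>.\<close>

lemma spray_P_origin:
  assumes "(0, 0) \<in> W"
  shows "spray_P \<psi> 0 0 = \<psi>s 0 0 / (2 * \<psi> 0 0)"
proof -
  have lim: "((\<lambda>r. f r 0) \<longlongrightarrow> f 0 0) (at_right 0)" if "smooth_on W (\<lambda>(r, s). f r s)" for f :: "real \<Rightarrow> real \<Rightarrow> real"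
  proof -
    have "isCont (\<lambda>(r, s). f r s) (0, 0)"
      using smooth_on_continuous[OF that] open_W assms by (simp add: continuous_on_eq_continuous_at)
    from isCont_tendsto_compose[OF this, of "\<lambda>r. (r, 0)" "at_right 0"]
    show ?thesis by (simp add: tendsto_Pair)
  qed
  have \<psi>: "\<psi> 0 0 \<noteq> 0" using \<psi>_pos[OF assms] by simp
  have r: "((\<lambda>r::real. r) \<longlongrightarrow> 0) (at_right 0)" by simp
  let ?f = "\<lambda>r. \<psi>s r 0 / (2 * \<psi> r 0)
     - r * \<psi>s r 0 / \<psi> r 0 * ((r * \<psi>ss r 0 - \<psi>r r 0) / (2 * (\<psi> r 0 + r\<^sup>2 * \<psi>ss r 0)))"
  have "(?f \<longlongrightarrow> \<psi>s 0 0 / (2 * \<psi> 0 0)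
     - 0 * \<psi>s 0 0 / \<psi> 0 0 * ((0 * \<psi>ss 0 0 - \<psi>r 0 0) / (2 * (\<psi> 0 0 + 0\<^sup>2 * \<psi>ss 0 0)))) (at_right 0)"
    by (intro tendsto_intros r lim smooth_\<psi> smooth_Ds smooth_Dss smooth_Dr) (use \<psi> in auto)
  moreover have "P_formula \<psi> r 0 = ?f r" if "r > 0" for r
    using that by (simp add: P_formula_def Q_formula_def power2_eq_square)
  then have "\<forall>\<^sub>F r in at_right 0. P_formula \<psi> r 0 = ?f r"
    by (simp add: eventually_at_right_less eventually_mono[OF eventually_at_right_less])
  ultimately have "((\<lambda>r. P_formula \<psi> r 0) \<longlongrightarrow> \<psi>s 0 0 / (2 * \<psi> 0 0)) (at_right 0)"
    by (simp add: tendsto_cong)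
  then show ?thesis unfolding spray_P_def by (simp add: tendsto_Lim)
qed

section \<open>Dimension one\<close>

text \<open>On the half line of \<open>y\<close> homogeneity gives \<open>F(x', z) = (z/y) F(x', y)\<close>. Hence \<open>g\<close> is constant there and
  the spray is a constant multiple of \<open>z\<^sup>2\<close>, whose third derivative vanishes.\<close>

lemma E_curvature_dim1:
  assumes x: "x \<in> U" and y: "y \<noteq> 0" and n: "CARD('n) = 1"
  shows "E_curvature F i j x y = 0"
proof -
  have UN: "UNIV = {i}" using n by (metis UNIV_I card_1_singletonE singletonD)
  have all: "k = i" for k using UN by (metis UNIV_I singletonD)
  define b where "b = y $ i"
  have b: "b \<noteq> 0" using y unfolding b_def vec_eq_iff by (metis all zero_index)
  \<comment> \<open>The open half line of directions that are positive multiples of \<open>y\<close>.\<close>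
  define S where "S = {z :: real^'n. z $ i * b > 0}"
  have S: "open S" unfolding S_def by (intro open_Collect_less continuous_intros)
  have yS: "y \<in> S" using b unfolding S_def b_def by (simp add: zero_less_mult_iff) auto
  have hom: "F x' z = z $ i / b * F x' y" if "x' \<in> U" "z \<in> S" for x' z
  proof -
    have "z $ k = ((z $ i / b) *\<^sub>R y) $ k" for k
      using b all[of k] by (simp add: b_def)
    then have "z = (z $ i / b) *\<^sub>R y" unfolding vec_eq_iff by blast
    moreover have "z $ i / b > 0"
      using that(2) unfolding S_def by (auto simp: zero_less_mult_iff zero_less_divide_iff)
    ultimately show ?thesis
      using finsler that(1) unfolding finsler_metric_on_def by metis
  qed
  have coord: "has_pd i (\<lambda>z. z $ i) 1 z" for z using has_pd_component[of i i z] by simp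
  have const: "has_pd i (\<lambda>z. c * z $ i) c z" for c z
    using has_pd_mult[OF has_pd_const[of i c] coord] by simp
  have sq: "has_pd i (\<lambda>z. c * (z $ i * z $ i)) (2 * c * z $ i) z" for c z
    by (rule has_pd_eq[OF has_pd_mult[OF has_pd_const has_pd_mult[OF coord coord]]]) simp
  define a where "a = (F x y / b)\<^sup>2"
  have F2: "(F x z)\<^sup>2 = a * (z $ i * z $ i)" if "z \<in> S" for z
    using hom[OF x that] by (simp add: a_def power2_eq_square)
  have pdF2: "pd i (\<lambda>z. (F x z)\<^sup>2) z = 2 * a * z $ i" if "z \<in> S" for z
    by (rule has_pd_imp_pd[OF has_pd_cong[OF sq S that F2]])
  have "pd i (pd i (\<lambda>z. (F x z)\<^sup>2)) z = 2 * a" if "z \<in> S" for z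
    by (rule has_pd_imp_pd[OF has_pd_cong[OF const S that pdF2]])
  then have "fund_tensor F x z $ k $ l = a" if "z \<in> S" for z k l
    using that unfolding fund_tensor_def all[of k] all[of l] by simp
  then have M: "fund_tensor F x z = (\<chi> i j. a)" if "z \<in> S" for z
    using that by (simp add: vec_eq_iff)
  obtain d where d: "has_pd i (\<lambda>x'. F x' y) d x" using has_pd_F_base[OF x y] .
  define e where "e = 2 * d * F x y / b\<^sup>2"
  have base: "pd i (\<lambda>x'. (F x' z)\<^sup>2) x = e * (z $ i * z $ i)" if "z \<in> S" for z
  proof -
    note c = has_pd_mult[OF has_pd_const[of i "z $ i / b"] d]
    have "has_pd i (\<lambda>x'. (z $ i / b * F x' y) * (z $ i / b * F x' y)) (e * (z $ i * z $ i)) x"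
      by (rule has_pd_eq[OF has_pd_mult[OF c c]]) (use b in \<open>simp add: e_def field_simps power2_eq_square\<close>)
    then show ?thesis
      by (rule has_pd_imp_pd[OF has_pd_cong[OF _ open_U x]])
        (use hom that in \<open>simp add: power2_eq_square\<close>)
  qed
  have mixed: "pd i (\<lambda>y'. pd i (\<lambda>x'. (F x' y')\<^sup>2) x) z = 2 * e * z $ i" if "z \<in> S" for z
    by (rule has_pd_imp_pd[OF has_pd_cong[OF sq S that base]])
  define m where "m = 1/4 * (matrix_inv (\<chi> i j. a :: real^'n^'n) $ i $ i * e)"
  have G: "spray F i x z = m * (z $ i * z $ i)" if "z \<in> S" for z
    unfolding spray_def UN using that by (simp add: M base mixed m_def algebra_simps)
  have div: "(\<Sum>k\<in>UNIV. pd k (\<lambda>y. spray F k x y) z) = 2 * m * z $ i" if "z \<in> S" for z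
    unfolding UN using has_pd_imp_pd[OF has_pd_cong[OF sq S that G]] by simp
  have "pd i (\<lambda>y. \<Sum>k\<in>UNIV. pd k (\<lambda>y. spray F k x y) y) z = 2 * m" if "z \<in> S" for z
    by (rule has_pd_imp_pd[OF has_pd_cong[OF const S that div]])
  from has_pd_imp_pd[OF has_pd_cong[OF has_pd_const S yS this]]
  show ?thesis unfolding E_curvature_def all[of j] by simp
qed

end

section \<open>The curvature formula\<close>

text \<open>The compact form of the Hessian, sorted by the four tensors \<open>x\<^sup>i x\<^sup>j\<close>, \<open>x\<^sup>i y\<^sup>j + y\<^sup>i x\<^sup>j\<close>, \<open>y\<^sup>i y\<^sup>j\<close>, \<open>\<delta>\<^sub>i\<^sub>j\<close>.\<close>

lemma E_formula_expand:
  fixes u s xi xj yi yj \<delta> n V p p1 p2 q1 q2 q3 :: real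
  assumes "u \<noteq> 0"
  shows "1/2 * (1 / u * (((n + 1) * (p - s * p1) + V * (q1 - s * q2)) * (\<delta> - yi * yj / u\<^sup>2)
      + ((n + 1) * p2 + 2 * q1 - 2 * s * q2 + V * q3) * (xi - s * yi / u) * (xj - s * yj / u)))
    = 1/2 * (
        1/u * ((n+1) * p2 + 2 * q1 + V * q3 - 2 * s * q2) * (xi * xj)
      + 1/u^2 * (- (n+1) * s * p2 - 2 * s * q1 - s * V * q3 + 2 * s\<^sup>2 * q2) * (xi * yj + yi * xj)
      + 1/u^3 * ((n+1) * s\<^sup>2 * p2 + 2 * s\<^sup>2 * q1 + s\<^sup>2 * V * q3 - 2 * s^3 * q2
          + (n+1) * s * p1 - (n+1) * p + s * V * q2 - V * q1) * (yi * yj)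
      + 1/u * (- (n+1) * s * p1 + (n+1) * p - s * V * q2 + V * q1) * \<delta>)"
  using assms by (simp add: field_simps power2_eq_square power3_eq_cube)

theorem theorem3p1:
  fixes U :: "(real^'n) set" and F :: "real^'n \<Rightarrow> real^'n \<Rightarrow> real"
    and W :: "(real \<times> real) set" and \<psi> :: "real \<Rightarrow> real \<Rightarrow> real"
    and x y :: "real^'n" and i j :: 'n
  assumes "open U"
    and "finsler_metric_on U F"
    and "spherically_symmetric_on U F"
    and "open W"
    and "\<And>x y. x \<in> U \<Longrightarrow> y \<noteq> 0 \<Longrightarrow> (norm x, (x \<bullet> y) / norm y) \<in> W"
    and "smooth_on W (\<lambda>(r, s). \<psi> r s)"
    and "\<And>r s. (r, s) \<in> W \<Longrightarrow> \<psi> r s > 0"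
    and "\<And>x y. x \<in> U \<Longrightarrow> y \<noteq> 0 \<Longrightarrow> F x y = norm y * \<psi> (norm x) ((x \<bullet> y) / norm y)"
    and "x \<in> U" and "y \<noteq> 0"
  shows "E_curvature F i j x y =
    (let n = real CARD('n);
         r = norm x; u = norm y; v = x \<bullet> y; s = v / u;
         P = spray_P \<psi> r s; P\<^sub>s = Ds (spray_P \<psi>) r s; P\<^sub>s\<^sub>s = Ds (Ds (spray_P \<psi>)) r s;
         Q\<^sub>s = Ds (spray_Q \<psi>) r s; Q\<^sub>s\<^sub>s = Ds (Ds (spray_Q \<psi>)) r s;
         Q\<^sub>s\<^sub>s\<^sub>s = Ds (Ds (Ds (spray_Q \<psi>))) r s
     in 1/2 * (
        1/u * ((n+1) * P\<^sub>s\<^sub>s + 2 * Q\<^sub>s + (r\<^sup>2 - s\<^sup>2) * Q\<^sub>s\<^sub>s\<^sub>s - 2 * s * Q\<^sub>s\<^sub>s) * (x$i * x$j)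
      + 1/u^2 * (- (n+1) * s * P\<^sub>s\<^sub>s - 2 * s * Q\<^sub>s - s * (r\<^sup>2 - s\<^sup>2) * Q\<^sub>s\<^sub>s\<^sub>s + 2 * s\<^sup>2 * Q\<^sub>s\<^sub>s)
          * (x$i * y$j + y$i * x$j)
      + 1/u^3 * ((n+1) * s\<^sup>2 * P\<^sub>s\<^sub>s + 2 * s\<^sup>2 * Q\<^sub>s + s\<^sup>2 * (r\<^sup>2 - s\<^sup>2) * Q\<^sub>s\<^sub>s\<^sub>s - 2 * s^3 * Q\<^sub>s\<^sub>s
          + (n+1) * s * P\<^sub>s - (n+1) * P + s * (r\<^sup>2 - s\<^sup>2) * Q\<^sub>s\<^sub>s - (r\<^sup>2 - s\<^sup>2) * Q\<^sub>s) * (y$i * y$j)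
      + 1/u * (- (n+1) * s * P\<^sub>s + (n+1) * P - s * (r\<^sup>2 - s\<^sup>2) * Q\<^sub>s\<^sub>s + (r\<^sup>2 - s\<^sup>2) * Q\<^sub>s)
          * (if i = j then 1 else 0)))"
proof -
  interpret spherical_metric U F W \<psi>
    by standard (use assms(1,2,4-8) in \<open>auto simp: dir_comp_def\<close>)
  let ?r = "norm x" and ?s = "dir_comp x y" and ?u = "norm y"
  have x: "x \<in> U" and y: "y \<noteq> 0" by fact+
  have u: "?u \<noteq> 0" using y by simp
  have "E_curvature F i j x y = 1/2 * (1 / ?u *
      (((real CARD('n) + 1) * (spray_P \<psi> ?r ?s - ?s * Ds (spray_P \<psi>) ?r ?s)
          + (?r\<^sup>2 - ?s\<^sup>2) * (Ds (spray_Q \<psi>) ?r ?s - ?s * Ds (Ds (spray_Q \<psi>)) ?r ?s))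
          * ((if i = j then 1 else 0) - y $ i * y $ j / ?u\<^sup>2)
      + ((real CARD('n) + 1) * Ds (Ds (spray_P \<psi>)) ?r ?s + 2 * Ds (spray_Q \<psi>) ?r ?s
          - 2 * ?s * Ds (Ds (spray_Q \<psi>)) ?r ?s + (?r\<^sup>2 - ?s\<^sup>2) * Ds (Ds (Ds (spray_Q \<psi>))) ?r ?s)
          * (x $ i - ?s * y $ i / ?u) * (x $ j - ?s * y $ j / ?u)))"
  proof -
    consider "CARD('n) = 1" | "CARD('n) \<ge> 2" "x \<noteq> 0" | "x = 0"
      using zero_less_card_finite[where 'a='n] by linarith
    then show ?thesis
    proof cases
      case 1
      have all: "k = i" for k using 1 by (metis UNIV_I card_1_singletonE singletonD)
      then have UN: "UNIV = {i}" by auto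
      \<comment> \<open>In dimension one \<open>x\<close> is parallel to \<open>y\<close>, so \<open>r\<^sup>2 = s\<^sup>2\<close> and both tensors of the Hessian vanish.\<close>
      have v: "x \<bullet> y = x $ i * y $ i" "y \<bullet> y = y $ i * y $ i" "x \<bullet> x = x $ i * x $ i"
        by (simp_all add: inner_vec_def UN)
      have y2: "y $ i * y $ i = ?u\<^sup>2" using v(2) by (simp add: power2_norm_eq_inner)
      have "?s * ?u = x $ i * y $ i" using y v(1) by (simp add: dir_comp_def)
      then have "?s * y $ i * ?u = x $ i * ?u\<^sup>2"
        by (simp flip: y2)
      then have x1: "x $ i - ?s * y $ i / ?u = 0" using u by (simp add: field_simps power2_eq_square)
      have "?s\<^sup>2 * ?u\<^sup>2 = ?r\<^sup>2 * ?u\<^sup>2"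
        using \<open>?s * ?u = x $ i * y $ i\<close> v y2
        by (metis power_mult_distrib power2_norm_eq_inner power2_eq_square)
      then have V: "?r\<^sup>2 - ?s\<^sup>2 = 0" using u by simp
      have y1: "1 - y $ i * y $ i / ?u\<^sup>2 = 0" and "y $ i \<noteq> 0" using u y2 by auto
      show ?thesis unfolding all[of j] E_curvature_dim1[OF x y 1] V x1 using y1 \<open>y $ i \<noteq> 0\<close> by simp
    next
      case 2
      then have r: "?r \<noteq> 0" by simp
      note sm = spray_coeffs_smooth[OF r]
      show ?thesis unfolding Ds_eq_deriv
      proof (rule E_curvature_of_spray[OF y sm(1) _ sm(2,3)])
        show "dir_comp x z \<in> {s. (?r, s) \<in> W \<and> \<Delta> ?r s \<noteq> 0}" if "z \<noteq> 0" for z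
          using dir_comp_in_W[OF x that] \<Delta>_pos[OF x that 2(1)] by simp
        show "spray F k x z = norm z * spray_P \<psi> ?r (dir_comp x z) * z $ k
           + (norm z)\<^sup>2 * spray_Q \<psi> ?r (dir_comp x z) * x $ k" if "z \<noteq> 0" for k z
          using spray_eq[OF x 2(2) that 2(1)] r by (simp add: spray_P_def spray_Q_def)
      qed
    next
      case 3
      \<comment> \<open>At \<open>x = 0\<close> each derivative of \<open>P\<close> or \<open>Q\<close> is multiplied by \<open>s\<close>, \<open>r\<^sup>2 - s\<^sup>2\<close>, or a component of
        \<open>x - (s/u) y\<close>, all of which are zero there.\<close>
      have W: "(0, 0) \<in> W" using dir_comp_in_W[OF x y] 3 by simp
      have "E_curvature F i j x y = 1/2 * (1 / ?u *
        (((real CARD('n) + 1) * (spray_P \<psi> 0 0 - ?s * deriv (\<lambda>_. spray_P \<psi> 0 0) ?s)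
          + (?r\<^sup>2 - ?s\<^sup>2) * (deriv (\<lambda>_. 0) ?s - ?s * deriv (deriv (\<lambda>_. 0)) ?s))
          * ((if i = j then 1 else 0) - y $ i * y $ j / ?u\<^sup>2)
        + ((real CARD('n) + 1) * deriv (deriv (\<lambda>_. spray_P \<psi> 0 0)) ?s + 2 * deriv (\<lambda>_. 0) ?s
          - 2 * ?s * deriv (deriv (\<lambda>_. 0)) ?s + (?r\<^sup>2 - ?s\<^sup>2) * deriv (deriv (deriv (\<lambda>_. 0))) ?s)
          * (x $ i - ?s * y $ i / ?u) * (x $ j - ?s * y $ j / ?u)))"
        by (rule E_curvature_of_spray[OF y open_UNIV])
          (use 3 x spray_origin spray_P_origin[OF W] in \<open>auto intro!: diff_times_const\<close>)
      then show ?thesis using 3 by simp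
    qed
  qed
  then show ?thesis
    unfolding Let_def dir_comp_def[symmetric] E_formula_expand[OF u] .
qed

end
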